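(* For every $n \ge 1$, $$\nu_1(2,n) = t(n,4) = \left(\tfrac{3}{4} + o(1)\right)\binom{n}{2} \quad (\text{with } o(1) \to 0 \text{ as } n \to \infty),$$ and $$\nu_{d-1}(d,n) = \binom{n}{2} \quad \text{for all } d \ge 3,$$ where $t(n,4)$ is the Turán number, i.e., the maximum number of edges in a graph on $n$ vertices that contains no complete subgraph on $5$ vertices, and $\nu_k(d,n)$ is the maximum number of $k$-flats in the strong cover of the complement of a union of $n$ convex sets in $\mathbb{R}^d$.
   Context: A flat is an affine subspace of $\mathbb{R}^d$; a $k$-flat is a $k$-dimensional affine subspace. $B(p,\epsilon)$ is the open ball of radius $\epsilon$ centered at $p$. For $k \ge -1$, a $k$-simplex is the convex hull of $k+1$ affinely independent points of $\mathbb{R}^d$. For $S \subset \mathbb{R}^d$, the flat-dimension is $dm(S) = \max\{k : S \text{ includes a } k\text{-simplex}\}$ (so $dm(\emptyset)=-1$). For $p \in S$, the local dimension of $S$ at $p$ is $dm(S,p) = \min_{\epsilon > 0} dm(S \cap B(p,\epsilon))$. A strong cover of $S$ is a finite collection $\mathcal{C}$ of flats such that each $p \in S$ belongs to some flat of $\mathcal{C}$ of dimension $dm(S,p)$, and no proper subcollection of $\mathcal{C}$ has this property. For $S = \mathbb{R}^d \setminus (\bigcup_{i=1}^n K_i)$ with $K_1,\ldots,K_n$ convex, $S$ has a unique strong cover $\mathcal{C}$; it equals the collection of all ordinary flats of $S$, where a $k$-flat $H$ is ($k$-)ordinary for $S$ if there are a point $p \in S$ with $dm(S,p)=k$ and an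 open neighborhood $U$ of $p$ with $S \cap U = H \cap U$. For such $S$ and $0 \le k \le d$, $\nu_k(S)$ denotes the number of $k$-flats in the strong cover $\mathcal{C}$ of $S$, and $\nu_k(d,n)$ denotes the maximum of $\nu_k(S)$ over all sets $S = \mathbb{R}^d \setminus (\bigcup_{i=1}^n K_i)$ with $K_1,\ldots,K_n \subset \mathbb{R}^d$ convex. *)

theory Defs
  imports "HOL-Analysis.Analysis" "HOL-Library.Ramsey"
begin

text \<open>
  The library relation \<open>k simplex T\<close> already follows the convention \<open>(-1) simplex {}\<close>, so the
  flat-dimension of the empty set is \<open>-1\<close>. The values of \<open>k\<close> range over \<open>{-1..DIM('a)}\<close>, so the
  maximum and the minimum below are taken over finite nonempty sets.
\<close>

definition flat_dim :: "'a::euclidean_space set \<Rightarrow> int" where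
  "flat_dim S = Max {k. \<exists>T. k simplex T \<and> T \<subseteq> S}"

definition local_dim :: "'a::euclidean_space set \<Rightarrow> 'a \<Rightarrow> int" where
  "local_dim S p = Min {flat_dim (S \<inter> ball p \<epsilon>) | \<epsilon>. \<epsilon> > 0}"

definition covers_strongly :: "'a::euclidean_space set set \<Rightarrow> 'a set \<Rightarrow> bool" where
  "covers_strongly \<C> S \<longleftrightarrow> (\<forall>p\<in>S. \<exists>H\<in>\<C>. p \<in> H \<and> aff_dim H = local_dim S p)"

definition strong_cover :: "'a::euclidean_space set \<Rightarrow> 'a set set \<Rightarrow> bool" where
  "strong_cover S \<C> \<longleftrightarrow>
     finite \<C> \<and> (\<forall>H\<in>\<C>. affine H) \<and> covers_strongly \<C> S \<and>
     (\<forall>\<C>'. \<C>' \<subset> \<C> \<longrightarrow> \<not> covers_strongly \<C>' S)"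

definition convex_union_compl :: "nat \<Rightarrow> 'a::euclidean_space set \<Rightarrow> bool" where
  "convex_union_compl n S \<longleftrightarrow>
     (\<exists>K :: nat \<Rightarrow> 'a set. (\<forall>i\<in>{1..n}. convex (K i)) \<and> S = UNIV - (\<Union>i\<in>{1..n}. K i))"

text \<open>
  The description operator is meaningful for the sets \<open>S\<close> with \<open>convex_union_compl n S\<close>, which
  have exactly one strong cover.
\<close>

definition nu :: "int \<Rightarrow> 'a::euclidean_space set \<Rightarrow> nat" where
  "nu k S = card {H \<in> (THE \<C>. strong_cover S \<C>). aff_dim H = k}"

text \<open>The ambient space, and with it the dimension \<open>d\<close>, is given by the type argument.\<close>

definition nu_max :: "'a::euclidean_space itself \<Rightarrow> int \<Rightarrow> nat \<Rightarrow> nat" where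
  "nu_max _ k n = Max {nu k S | S :: 'a set. convex_union_compl n S}"

text \<open>
  Simple graphs on the vertex set \<open>{..<n}\<close> are given by their sets of two-element edges.
\<close>

definition turan_number :: "nat \<Rightarrow> nat \<Rightarrow> nat" where
  "turan_number n r =
     Max {card E | E. E \<subseteq> nsets {..<n} 2 \<and> \<not> (\<exists>V \<in> nsets {..<n} (r + 1). clique V E)}"

end

theory Submission
  imports Defs "HOL-Real_Asymp.Real_Asymp"
begin

text \<open>
  Let \<open>S\<close> be the complement of the union of convex sets \<open>K i\<close>. The points of local dimension at
  most \<open>k\<close> lie in finitely many flats of dimension at most \<open>k\<close>; from this it follows that the
  ordinary flats form the only strong cover of \<open>S\<close>.

  An ordinary hyperplane \<open>H\<close> weakly separates two sets \<open>K i\<close>, \<open>K j\<close> whose closures share a subset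
  spanning \<open>H\<close>. Hence \<open>H\<close> is determined by \<open>{i, j}\<close>, and there are at most \<open>n choose 2\<close> ordinary
  hyperplanes. In the plane, a complete graph on five of the indices would yield a planar
  drawing of \<open>K_5\<close>, with an interior point of each of the five sets as a vertex and with edges
  through common boundary points.

  Both bounds are attained by open polyhedra. In dimension at least 3, the sets form a neighbourly
  power diagram. In the plane, the sets are small perturbations of four pairwise adjacent regions,
  such that each common boundary becomes a broken line with one edge for every pair of sets from
  the two classes; Turan's theorem says that complete 4-partite graphs are optimal.
\<close>

section \<open>Finite unions of flats\<close>

text \<open>A convex set covered by finitely many flats lies in one of them. This fact turns a cover
  of a piece of a hyperplane by common limit points of pairs \<open>K i\<close>, \<open>K j\<close>
  into one pair whose common limit points span the hyperplane, and it also supplies points in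
  general position. In the plane the obstacle is that three closures may meet, so that arcs through
  common boundary points could collide. If a third set touches both members of a pair, however, a
  relative interior point of their common boundary avoids its closure, since otherwise the three
  sets would lie pairwise on opposite sides of one line. In a clique every third set does touch
  both. The theta-curve argument only excludes two vertices inside a triangle; two vertices outside
  are brought inside by an inversion. The planar construction has two scales. Between two fixed
  classes the signs are exact at every positive scale, because the broken line is shrunk
  parabolically; all other comparisons are strict in the limit and hence hold at a small
  scale.\<close>

lemma finite_Int_segment_affine:
  fixes p q :: "'a::euclidean_space"
  assumes "affine A" "p \<notin> A \<or> q \<notin> A"
  shows "finite (closed_segment p q \<inter> A)"
proof (rule ccontr)
  assume inf: "infinite (closed_segment p q \<inter> A)"
  then obtain x where x: "x \<in> closed_segment p q \<inter> A"
    by (metis finite.emptyI ex_in_conv)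
  from inf have "infinite (closed_segment p q \<inter> A - {x})" by simp
  then obtain y where y: "y \<in> closed_segment p q \<inter> A" "y \<noteq> x"
    by (metis finite.emptyI ex_in_conv DiffE singletonI)
  obtain s where s: "x = p + s *\<^sub>R (q - p)"
    using x by (auto simp: in_segment algebra_simps)
  obtain t where t: "y = p + t *\<^sub>R (q - p)"
    using y by (auto simp: in_segment algebra_simps)
  have st: "s \<noteq> t" using s t y by auto
  have line: "x + r *\<^sub>R (y - x) \<in> A" for r
    using x y assms(1) mem_affine_3_minus[of A x y x r] by auto
  have yx: "y - x = (t - s) *\<^sub>R (q - p)" by (simp add: s t algebra_simps)
  have "p = x + (- s / (t - s)) *\<^sub>R (y - x)"
    using st unfolding yx by (simp add: s)
  moreover have "q = x + ((1 - s) / (t - s)) *\<^sub>R (y - x)"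
  proof -
    have "x + ((1 - s) / (t - s)) *\<^sub>R (y - x) = x + (1 - s) *\<^sub>R (q - p)"
      using st unfolding yx by simp
    then show ?thesis by (simp add: s algebra_simps)
  qed
  ultimately have "p \<in> A" "q \<in> A" using line by metis+
  then show False using assms(2) by blast
qed

text \<open>A segment from a point outside \<open>A\<close> to a point outside
  \<open>\<Union>F\<close> would meet each of the finitely many flats in finitely many points only,
  and yet be covered by them.\<close>

lemma convex_subset_Union_affine:
  fixes C :: "'a::euclidean_space set"
  assumes "finite F" "\<And>A. A \<in> F \<Longrightarrow> affine A" "convex C" "C \<subseteq> \<Union>F" "C \<noteq> {}"
  shows "\<exists>A\<in>F. C \<subseteq> A"
  using assms
proof (induction F rule: finite_induct)
  case empty
  then show ?case by auto
next
  case (insert A F)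
  show ?case
  proof (cases "C \<subseteq> A \<or> C \<subseteq> \<Union>F")
    case True
    then show ?thesis using insert by auto
  next
    case False
    then obtain p q where p: "p \<in> C" "p \<notin> A" and q: "q \<in> C" "q \<notin> \<Union>F" by auto
    have seg: "closed_segment p q \<subseteq> C"
      using p q insert.prems(2) by (simp add: closed_segment_subset)
    have "p \<noteq> q" using p q insert.prems by auto
    then have "infinite (closed_segment p q)" by simp
    moreover have "closed_segment p q = (\<Union>B\<in>insert A F. closed_segment p q \<inter> B)"
      using seg insert.prems by auto
    moreover have "finite (closed_segment p q \<inter> B)" if "B \<in> insert A F" for B
      using that p q insert.prems(1)[of B] by (intro finite_Int_segment_affine) auto
    ultimately have False using insert.hyps(1)
      by (metis (no_types, lifting) finite_UN finite_insert)
    then show ?thesis ..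
  qed
qed

section \<open>Flat dimension and local dimension\<close>

lemma simplex_in_convex:
  fixes C :: "'a::euclidean_space set"
  assumes "convex C"
  shows "\<exists>T. aff_dim C simplex T \<and> T \<subseteq> C"
proof -
  obtain B where B: "B \<subseteq> C" "\<not> affine_dependent B" "affine hull C = affine hull B"
    using affine_basis_exists[of C] by auto
  have "int (card B) = aff_dim C + 1"
    using aff_dim_affine_independent[OF B(2)] B(3) aff_dim_affine_hull[of B] aff_dim_affine_hull[of C]
    by simp
  then have "aff_dim C simplex (convex hull B)" using B(2) by (auto simp: simplex_def)
  moreover have "convex hull B \<subseteq> C" using B(1) assms by (simp add: hull_minimal)
  ultimately show ?thesis by blast
qed

lemma simplex_dims_bounded:
  "{k. \<exists>T. k simplex T \<and> T \<subseteq> (S :: 'a::euclidean_space set)} \<subseteq> {-1..int DIM('a)}"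
proof
  fix k assume "k \<in> {k. \<exists>T. k simplex T \<and> T \<subseteq> S}"
  then obtain T :: "'a set" where T: "k simplex T" by blast
  then have "aff_dim T = k" by (rule aff_dim_simplex)
  then show "k \<in> {-1..int DIM('a)}" using aff_dim_le_DIM[of T] aff_dim_geq[of T] by auto
qed

lemma simplex_dims_finite_nonempty:
  "finite {k. \<exists>T. k simplex T \<and> T \<subseteq> (S :: 'a::euclidean_space set)}"
  "{k. \<exists>T. k simplex T \<and> T \<subseteq> (S :: 'a::euclidean_space set)} \<noteq> {}"
proof -
  show "finite {k. \<exists>T. k simplex T \<and> T \<subseteq> S}"
    using simplex_dims_bounded by (rule finite_subset) simp
  have "(-1) simplex ({} :: 'a set)"
    unfolding simplex_def by (rule exI[of _ "{}"]) (simp add: affine_dependent_def)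
  then have "-1 \<in> {k. \<exists>T. k simplex T \<and> T \<subseteq> S}" by auto
  then show "{k. \<exists>T. k simplex T \<and> T \<subseteq> S} \<noteq> {}" by blast
qed

lemma aff_dim_le_flat_dim:
  fixes C :: "'a::euclidean_space set"
  assumes "convex C" "C \<subseteq> S"
  shows "aff_dim C \<le> flat_dim S"
  unfolding flat_dim_def
  by (rule Max_ge[OF simplex_dims_finite_nonempty(1)]) (use simplex_in_convex[OF assms(1)] assms(2) in blast)

lemma flat_dim_attained:
  fixes S :: "'a::euclidean_space set"
  obtains C where "convex C" "C \<subseteq> S" "aff_dim C = flat_dim S"
proof -
  have "flat_dim S \<in> {k. \<exists>T. k simplex T \<and> T \<subseteq> S}"
    unfolding flat_dim_def by (rule Max_in[OF simplex_dims_finite_nonempty])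
  then show ?thesis using that convex_simplex aff_dim_simplex by blast
qed

lemma flat_dim_mono:
  fixes S T :: "'a::euclidean_space set"
  assumes "S \<subseteq> T"
  shows "flat_dim S \<le> flat_dim T"
proof -
  obtain C where "convex C" "C \<subseteq> S" "aff_dim C = flat_dim S" by (rule flat_dim_attained)
  then show ?thesis using aff_dim_le_flat_dim[of C T] assms by auto
qed

lemma flat_dim_range: "flat_dim (S :: 'a::euclidean_space set) \<in> {-1..int DIM('a)}"
proof -
  obtain C where "convex C" "C \<subseteq> S" "aff_dim C = flat_dim S" by (rule flat_dim_attained)
  then show ?thesis using aff_dim_le_DIM[of C] aff_dim_geq[of C] by auto
qed

lemma local_dims_finite:
  "finite {flat_dim (S \<inter> ball p \<epsilon>) | \<epsilon>. \<epsilon> > 0}" for p :: "'a::euclidean_space"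
  by (rule finite_subset[of _ "{-1..int DIM('a)}"]) (use flat_dim_range in blast, simp)

lemma local_dim_le:
  fixes p :: "'a::euclidean_space"
  assumes "\<epsilon> > 0"
  shows "local_dim S p \<le> flat_dim (S \<inter> ball p \<epsilon>)"
  unfolding local_dim_def by (rule Min_le[OF local_dims_finite]) (use assms in blast)

lemma local_dim_attained:
  fixes p :: "'a::euclidean_space"
  obtains \<epsilon> where "\<epsilon> > 0" "flat_dim (S \<inter> ball p \<epsilon>) = local_dim S p"
proof -
  have "{flat_dim (S \<inter> ball p \<epsilon>) | \<epsilon>. \<epsilon> > 0} \<noteq> {}" using zero_less_one by blast
  then have "local_dim S p \<in> {flat_dim (S \<inter> ball p \<epsilon>) | \<epsilon>. \<epsilon> > 0}"
    unfolding local_dim_def by (intro Min_in local_dims_finite)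
  then show ?thesis using that by auto
qed

text \<open>Near \<open>p\<close> every convex subset of \<open>S\<close> lies in \<open>H\<close>,
  and a small ball of \<open>H\<close> is such a subset and spans \<open>H\<close>.\<close>

lemma local_dim_flat:
  fixes H :: "'a::euclidean_space set"
  assumes H: "affine H" and U: "open U" "S \<inter> U = H \<inter> U" and p: "p \<in> H \<inter> U"
  shows "local_dim S p = aff_dim H"
proof (rule antisym)
  obtain r where r: "r > 0" "ball p r \<subseteq> U"
    using U p by (meson IntD2 open_contains_ball)
  have "local_dim S p \<le> flat_dim (S \<inter> ball p r)" using r by (intro local_dim_le)
  also obtain C where C: "convex C" "C \<subseteq> S \<inter> ball p r" "aff_dim C = flat_dim (S \<inter> ball p r)"
    by (rule flat_dim_attained)
  have "C \<subseteq> H" using C r U by auto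
  then have "flat_dim (S \<inter> ball p r) \<le> aff_dim H" using C(3) aff_dim_subset[of C H] by simp
  finally show "local_dim S p \<le> aff_dim H" .
next
  obtain e where e: "e > 0" "flat_dim (S \<inter> ball p e) = local_dim S p" by (rule local_dim_attained)
  obtain r where r: "r > 0" "ball p r \<subseteq> U"
    using U p by (meson IntD2 open_contains_ball)
  let ?C = "H \<inter> ball p (min r e)"
  have "?C \<subseteq> S \<inter> ball p e" using r U by auto
  moreover have "convex ?C" using H by (simp add: affine_imp_convex convex_Int)
  ultimately have "aff_dim ?C \<le> local_dim S p" using aff_dim_le_flat_dim e(2) by metis
  moreover have "affine hull ?C = affine hull H"
  proof (rule affine_hull_affine_Int_open[OF H])
    show "H \<inter> ball p (min r e) \<noteq> {}" using p r e by (auto simp: disjoint_iff)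
  qed simp
  ultimately show "aff_dim H \<le> local_dim S p" using aff_dim_affine_hull2 by metis
qed

section \<open>Points of small local dimension\<close>

text \<open>Such sets count as small. Smallness is preserved by finite unions, so a set that is not
  small keeps a part that is not small in every finite partition.\<close>

definition flat_coverable :: "int \<Rightarrow> 'a::euclidean_space set \<Rightarrow> bool" where
  "flat_coverable k X \<longleftrightarrow> (\<exists>F. finite F \<and> (\<forall>H\<in>F. affine H \<and> aff_dim H \<le> k) \<and> X \<subseteq> \<Union>F)"

lemma flat_coverable_affine_hull: "aff_dim X \<le> k \<Longrightarrow> flat_coverable k X"
  unfolding flat_coverable_def
  by (rule exI[of _ "{affine hull X}"]) (auto simp: aff_dim_affine_hull hull_inc)

lemma flat_coverable_UN:
  assumes "finite J" "\<And>j. j \<in> J \<Longrightarrow> flat_coverable k (X j)"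
  shows "flat_coverable k (\<Union>j\<in>J. X j)"
proof -
  from assms(2) have "\<forall>j\<in>J. \<exists>F. finite F \<and> (\<forall>H\<in>F. affine H \<and> aff_dim H \<le> k) \<and> X j \<subseteq> \<Union>F"
    unfolding flat_coverable_def by blast
  from bchoice[OF this]
  obtain F where F: "\<forall>j\<in>J. finite (F j) \<and> (\<forall>H\<in>F j. affine H \<and> aff_dim H \<le> k) \<and> X j \<subseteq> \<Union>(F j)"
    by blast
  have "finite (\<Union>j\<in>J. F j)" using F assms(1) by simp
  moreover have "\<forall>H\<in>(\<Union>j\<in>J. F j). affine H \<and> aff_dim H \<le> k" using F by simp
  moreover have "(\<Union>j\<in>J. X j) \<subseteq> \<Union>(\<Union>j\<in>J. F j)"
  proof
    fix x assume "x \<in> (\<Union>j\<in>J. X j)"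
    then obtain j where "j \<in> J" "x \<in> X j" by blast
    then show "x \<in> \<Union>(\<Union>j\<in>J. F j)" using F by (meson UN_I UnionE UnionI subsetD)
  qed
  ultimately show ?thesis unfolding flat_coverable_def by blast
qed

text \<open>The map is the homothety with centre \<open>m\<close> and ratio
  \<open>- t\<close>.\<close>

lemma aff_dim_reflection:
  fixes D :: "'a::euclidean_space set"
  assumes "t \<noteq> 0"
  shows "aff_dim ((\<lambda>z. m - t *\<^sub>R (z - m)) ` D) = aff_dim D"
proof -
  have "(\<lambda>z. m - t *\<^sub>R (z - m)) ` D = (+) (m + t *\<^sub>R m) ` ((\<lambda>z. (-t) *\<^sub>R z) ` D)"
    by (auto simp: image_image algebra_simps)
  moreover have "aff_dim ((\<lambda>z. (-t) *\<^sub>R z) ` D) = aff_dim D"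
    by (rule aff_dim_injective_linear_image) (use assms in \<open>auto intro!: injI bounded_linear.linear[OF bounded_linear_scaleR_right] simp del: scaleR_minus_left\<close>)
  ultimately show ?thesis by (simp only: aff_dim_translation_eq)
qed


lemma finite_family_closure_ball:
  fixes K :: "'i \<Rightarrow> 'a::euclidean_space set"
  assumes "finite I"
  obtains e where "e > 0" "\<And>i y. i \<in> I \<Longrightarrow> y \<in> K i \<Longrightarrow> dist m y < e \<Longrightarrow> m \<in> closure (K i)"
proof -
  let ?N = "{i \<in> I. m \<notin> closure (K i)}"
  have "open (- (\<Union>i\<in>?N. closure (K i)))"
    using assms by (intro open_Compl closed_UN) auto
  moreover have "m \<in> - (\<Union>i\<in>?N. closure (K i))" by auto
  ultimately obtain e where e: "e > 0" "ball m e \<subseteq> - (\<Union>i\<in>?N. closure (K i))"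
    by (meson open_contains_ball)
  have "m \<in> closure (K i)" if "i \<in> I" "y \<in> K i" "dist m y < e" for i y
  proof (rule ccontr)
    assume "m \<notin> closure (K i)"
    moreover have "y \<in> closure (K i)" using that closure_subset by auto
    ultimately show False using e that by auto
  qed
  with e(1) show ?thesis by (rule that)
qed

text \<open>
  Suppose the conclusion fails. Take a set of these points that is not coverable and has least dimension, spanning a flat \<open>A\<close>.
  By minimality, some set \<open>Y\<close> of its points that are adherent to the same \<open>K i\<close> still spans
  \<open>A\<close>; hence each of these \<open>K i\<close> contains the relative interior of the hull of \<open>Y\<close>. Reflecting
  a piece of this interior through a point \<open>m\<close> of \<open>Y\<close> gives a piece of dimension \<open>> k\<close> close to \<open>m\<close>,
  so one of these \<open>K i\<close> contains a point on the other side of \<open>m\<close>, and thus \<open>m\<close>.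
\<close>

theorem local_dim_le_coverable:
  fixes K :: "'i \<Rightarrow> 'a::euclidean_space set"
  assumes "finite I" and cv: "\<And>i. i \<in> I \<Longrightarrow> convex (K i)" and S: "S = UNIV - (\<Union>i\<in>I. K i)"
  shows "flat_coverable k {p \<in> S. local_dim S p \<le> k}"
proof (rule ccontr)
  let ?T = "{p \<in> S. local_dim S p \<le> k}"
  define big where "big X \<longleftrightarrow> X \<subseteq> ?T \<and> \<not> flat_coverable k X" for X
  assume "\<not> flat_coverable k ?T"
  then have "big ?T" by (simp add: big_def)
  \<comment> \<open>\<open>aff_dim\<close> starts at -1, hence the shift by one before passing to
    natural numbers.\<close>
  then obtain X where X: "big X" and
    Xmin: "\<And>Y. big Y \<Longrightarrow> nat (aff_dim X + 1) \<le> nat (aff_dim Y + 1)"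
    using ex_has_least_nat[of big ?T "\<lambda>X. nat (aff_dim X + 1)"] by blast
  have Xmin': "aff_dim X \<le> aff_dim Y" if "big Y" for Y
    using Xmin[OF that] aff_dim_geq[of X] aff_dim_geq[of Y] by linarith
  define A where "A = affine hull X"
  have affA: "affine A" by (simp add: A_def)
  have dimA: "aff_dim A > k"
    using X flat_coverable_affine_hull[of X k] by (fastforce simp: A_def big_def)
  \<comment> \<open>The closure is that of the trace on \<open>A\<close>, so a set that approaches
    \<open>m\<close> only from outside \<open>A\<close> does not count. There are finitely many
    values of \<open>J\<close>, and one of its classes is still not coverable.\<close>
  define J where "J m = {i \<in> I. m \<in> closure (K i \<inter> A)}" for m
  have "J m \<in> Pow I" for m by (auto simp: J_def)
  then have XU: "X = (\<Union>j\<in>Pow I. {m \<in> X. J m = j})" by blast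
  obtain j where "\<not> flat_coverable k {m \<in> X. J m = j}"
  proof (rule ccontr)
    assume "\<not> thesis"
    then have "flat_coverable k (\<Union>j\<in>Pow I. {m \<in> X. J m = j})"
      using that assms(1) by (intro flat_coverable_UN) auto
    then show False using X XU by (simp add: big_def)
  qed
  define Y where "Y = {m \<in> X. J m = j}"
  have Y: "big Y" "Y \<subseteq> X" and jY: "\<And>m. m \<in> Y \<Longrightarrow> J m = j"
    using X \<open>\<not> flat_coverable k {m \<in> X. J m = j}\<close> by (auto simp: Y_def big_def)
  have "Y \<noteq> {}"
    using Y(1) flat_coverable_UN[of "{}" k] by (auto simp: big_def)
  then obtain m where m: "m \<in> Y" by auto
  have hullY: "affine hull Y = A"
  proof (rule affine_dim_equal)
    show "aff_dim (affine hull Y) = aff_dim A"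
      using Xmin'[OF Y(1)] aff_dim_subset[OF Y(2)] by (simp add: A_def)
  qed (use \<open>Y \<noteq> {}\<close> Y(2) in \<open>simp_all add: A_def hull_mono\<close>)
  define C where "C = convex hull Y"
  have hullC: "affine hull C = A" by (simp add: C_def hullY)
  \<comment> \<open>\<open>C\<close> lies in the closure of the convex set
    \<open>K i \<inter> A\<close> and spans \<open>A\<close>, and closing a convex set does not
    enlarge its relative interior.\<close>
  have riC: "rel_interior C \<subseteq> K i" if "i \<in> j" for i
  proof -
    have i: "i \<in> I" using that jY[OF m] by (auto simp: J_def)
    have cKA: "convex (K i \<inter> A)" using cv[OF i] affA by (simp add: affine_imp_convex convex_Int)
    have "Y \<subseteq> closure (K i \<inter> A)" using that jY by (auto simp: J_def)
    then have sub: "C \<subseteq> closure (K i \<inter> A)"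
      unfolding C_def using cKA by (intro hull_minimal) auto
    have "closure (K i \<inter> A) \<subseteq> A"
      using affA by (intro closure_minimal) (auto simp: affine_closed)
    then have "affine hull (closure (K i \<inter> A)) = A"
      using sub hullC affA by (metis hull_mono hull_minimal subset_antisym)
    then have "rel_interior C \<subseteq> rel_interior (K i \<inter> A)"
      using subset_rel_interior[OF sub] hullC convex_rel_interior_closure[OF cKA] by simp
    then show ?thesis using rel_interior_subset by blast
  qed
  have "rel_interior C \<noteq> {}"
    using \<open>Y \<noteq> {}\<close> by (simp add: C_def rel_interior_eq_empty)
  then obtain z0 where z0: "z0 \<in> rel_interior C" by auto
  then obtain r where r: "r > 0" "ball z0 r \<inter> A \<subseteq> C"
    unfolding mem_rel_interior_ball hullC by auto
  define D where "D = A \<inter> ball z0 r"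
  have DC: "D \<subseteq> rel_interior C"
    using r hullC by (intro rel_interior_maximal) (auto simp: D_def openin_open)
  have z0A: "z0 \<in> A" using z0 hullC by (metis hull_inc rel_interior_subset subsetD)
  have "affine hull D = affine hull A"
    unfolding D_def using affA z0A r by (intro affine_hull_affine_Int_open) (auto simp: disjoint_iff)
  then have dimD: "aff_dim D = aff_dim A" by (rule aff_dim_affine_hull2)
  have mT: "m \<in> S" "local_dim S m \<le> k" using Y m by (auto simp: big_def)
  have mA: "m \<in> A" using m hullY by (metis hull_inc)
  obtain e1 where e1: "e1 > 0" "flat_dim (S \<inter> ball m e1) = local_dim S m"
    by (rule local_dim_attained)
  obtain e2 where e2: "e2 > 0"
    "\<And>i y. i \<in> I \<Longrightarrow> y \<in> K i \<inter> A \<Longrightarrow> dist m y < e2 \<Longrightarrow> m \<in> closure (K i \<inter> A)"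
    using finite_family_closure_ball[OF assms(1), of "\<lambda>i. K i \<inter> A" m] by blast
  define R where "R = dist m z0 + r"
  have R: "R > 0" using r by (simp add: R_def add_nonneg_pos)
  \<comment> \<open>\<open>D\<close> lies within distance \<open>R\<close> of \<open>m\<close>, so
    the homothety of ratio \<open>- t\<close> brings it to within half of
    \<open>min e1 e2\<close>.\<close>
  define t where "t = min e1 e2 / (2 * R)"
  have t: "t > 0" using R e1 e2 by (simp add: t_def)
  let ?\<phi> = "\<lambda>z. m - t *\<^sub>R (z - m)"
  have near: "dist m (?\<phi> z) < min e1 e2" if "z \<in> D" for z
  proof -
    have "dist m z \<le> R"
      using that dist_triangle[of m z z0] by (simp add: D_def R_def)
    then have "t * dist m z \<le> min e1 e2 / 2"
      using R t mult_left_mono[of "dist m z" R t] by (simp add: t_def)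
    moreover have "dist m (?\<phi> z) = t * dist m z"
      using t by (simp add: dist_norm norm_minus_commute)
    ultimately show ?thesis using e1 e2 by simp
  qed
  \<comment> \<open>The image of \<open>D\<close> has the dimension of \<open>A\<close>, which
    exceeds \<open>k\<close>, while the part of \<open>S\<close> this close to \<open>m\<close> has
    flat-dimension at most \<open>k\<close>.\<close>
  have "\<not> ?\<phi> ` D \<subseteq> S"
  proof
    assume "?\<phi> ` D \<subseteq> S"
    then have "?\<phi> ` D \<subseteq> S \<inter> ball m e1" using near by force
    moreover have "convex (?\<phi> ` D)"
    proof -
      have "?\<phi> = (\<lambda>z. (m + t *\<^sub>R m) + (- t) *\<^sub>R z)" by (auto simp: algebra_simps)
      moreover have "convex D" using affA by (simp add: D_def affine_imp_convex convex_Int)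
      ultimately show ?thesis by (simp only: convex_affinity)
    qed
    ultimately have "aff_dim (?\<phi> ` D) \<le> flat_dim (S \<inter> ball m e1)" by (intro aff_dim_le_flat_dim)
    then show False using aff_dim_reflection[of t m D] t dimD dimA e1(2) mT by simp
  qed
  then obtain z where z: "z \<in> D" "?\<phi> z \<notin> S" by auto
  then obtain i where i: "i \<in> I" "?\<phi> z \<in> K i" using S by auto
  have "?\<phi> z \<in> A"
    using mem_affine_3_minus[OF affA mA _ mA, of z "- t"] z(1)
    by (simp add: D_def)
  then have "i \<in> J m" using e2(2)[OF i(1)] i near[OF z(1)] by (auto simp: J_def)
  then have "z \<in> K i" using riC jY[OF m] DC z(1) by auto
  \<comment> \<open>With these weights, \<open>m\<close> is a convex combination of its two
    neighbours \<open>?\<phi> z\<close> and \<open>z\<close> on opposite sides.\<close>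
  then have "(1 / (1 + t)) *\<^sub>R ?\<phi> z + (t / (1 + t)) *\<^sub>R z \<in> K i"
    using cv[OF i(1)] i(2) t by (intro convexD) (auto simp: field_simps)
  also have "(1 / (1 + t)) *\<^sub>R ?\<phi> z + (t / (1 + t)) *\<^sub>R z = (1 / (1 + t)) *\<^sub>R (?\<phi> z + t *\<^sub>R z)"
    by (simp add: scaleR_add_right)
  also have "?\<phi> z + t *\<^sub>R z = (1 + t) *\<^sub>R m" by (simp add: algebra_simps)
  also have "(1 / (1 + t)) *\<^sub>R (1 + t) *\<^sub>R m = m" using t by simp
  finally show False using mT(1) S i(1) by auto
qed

section \<open>Ordinary flats\<close>

text \<open>By \<open>local_dim_flat\<close> the local dimension at each point of
  \<open>H \<inter> U\<close> is \<open>aff_dim H\<close>, so the condition on the dimension is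
  built in.\<close>

definition ordinary_flat :: "'a::euclidean_space set \<Rightarrow> 'a set \<Rightarrow> bool" where
  "ordinary_flat S H \<longleftrightarrow> affine H \<and> (\<exists>U. open U \<and> H \<inter> U \<noteq> {} \<and> S \<inter> U = H \<inter> U)"

text \<open>A small ball of \<open>H\<close> is convex, hence lies in one member of
  \<open>F\<close>, and it spans \<open>H\<close>.\<close>

lemma flat_subset_of_local_cover:
  fixes H :: "'a::euclidean_space set"
  assumes "finite F" "\<And>A. A \<in> F \<Longrightarrow> affine A" and H: "affine H"
    and U: "open U" "H \<inter> U \<noteq> {}" "H \<inter> U \<subseteq> \<Union>F"
  shows "\<exists>A\<in>F. H \<subseteq> A"
proof -
  obtain p where p: "p \<in> H" "p \<in> U" using U by auto
  then obtain r where r: "r > 0" "ball p r \<subseteq> U" using U by (meson open_contains_ball)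
  have "convex (H \<inter> ball p r)" using H by (simp add: affine_imp_convex convex_Int)
  moreover have "H \<inter> ball p r \<subseteq> \<Union>F" using r U by auto
  moreover have ne: "H \<inter> ball p r \<noteq> {}" using p r by (auto simp: disjoint_iff)
  ultimately obtain A where A: "A \<in> F" "H \<inter> ball p r \<subseteq> A"
    using convex_subset_Union_affine[OF assms(1,2)] by blast
  have "H = affine hull (H \<inter> ball p r)"
    using affine_hull_affine_Int_open[OF H _ ne] H by (simp add: hull_same)
  also have "\<dots> \<subseteq> A" using A assms(2) by (simp add: hull_minimal)
  finally show ?thesis using A(1) by blast
qed

text \<open>At the points of \<open>H \<inter> U\<close> only flats of dimension
  \<open>aff_dim H\<close> count, and one of these must include \<open>H\<close>.\<close>

lemma ordinary_flat_in_cover: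
  fixes H :: "'a::euclidean_space set"
  assumes "ordinary_flat S H" "finite \<C>" "\<And>C. C \<in> \<C> \<Longrightarrow> affine C" "covers_strongly \<C> S"
  shows "H \<in> \<C>"
proof -
  obtain U where H: "affine H" and U: "open U" "H \<inter> U \<noteq> {}" "S \<inter> U = H \<inter> U"
    using assms(1) by (auto simp: ordinary_flat_def)
  let ?F = "{C \<in> \<C>. aff_dim C = aff_dim H}"
  have "H \<inter> U \<subseteq> \<Union>?F"
  proof
    fix p assume p: "p \<in> H \<inter> U"
    then have "p \<in> S" using U(3) by blast
    then obtain C where "C \<in> \<C>" "p \<in> C" "aff_dim C = local_dim S p"
      using assms(4) by (auto simp: covers_strongly_def)
    then show "p \<in> \<Union>?F" using local_dim_flat[OF H U(1,3) p] by auto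
  qed
  moreover have "finite ?F" using assms(2) by simp
  ultimately obtain C where C: "C \<in> ?F" "H \<subseteq> C"
    using flat_subset_of_local_cover[of ?F H U] assms(3) H U by auto
  have "H = C" using C U assms(3) H by (intro affine_dim_equal) auto
  then show ?thesis using C by simp
qed

lemma aff_dim_eq_of_finite_cover:
  fixes C :: "'a::euclidean_space set"
  assumes "finite F" "\<And>H. H \<in> F \<Longrightarrow> affine H \<and> aff_dim H \<le> k"
    and C: "convex C" "C \<noteq> {}" "C \<subseteq> \<Union>F" "aff_dim C = k"
  shows "\<exists>H\<in>F. affine hull C = H"
proof -
  obtain H where H: "H \<in> F" "C \<subseteq> H"
    using convex_subset_Union_affine[of F C] assms by auto
  have "affine hull C = H"
  proof (rule affine_dim_equal)
    show "affine hull C \<subseteq> H" using H assms(2) by (simp add: hull_minimal)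
    then show "aff_dim (affine hull C) = aff_dim H"
      using aff_dim_subset[of C H] H assms(2)[OF H(1)] C(4) by simp
  qed (use C assms(2)[OF H(1)] in auto)
  then show ?thesis using H(1) by blast
qed

locale convex_cover =
  fixes I :: "'i set" and K :: "'i \<Rightarrow> 'a::euclidean_space set" and S :: "'a set"
  assumes finite_I: "finite I" and convex_K: "\<And>i. i \<in> I \<Longrightarrow> convex (K i)"
    and S_eq: "S = UNIV - (\<Union>i\<in>I. K i)"
begin

lemma minimal_cover:
  obtains F where "finite F" "\<And>H. H \<in> F \<Longrightarrow> affine H \<and> aff_dim H \<le> k"
    "{p \<in> S. local_dim S p \<le> k} \<subseteq> \<Union>F"
  using local_dim_le_coverable[OF finite_I convex_K S_eq, of k] unfolding flat_coverable_def
  by blast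

text \<open>Each such flat is a member of one fixed finite cover of the points of local dimension at
  most \<open>k\<close>.\<close>

lemma ordinary_of_dim_finite: "finite {H. ordinary_flat S H \<and> aff_dim H = k}"
proof -
  obtain F where F: "finite F" "\<And>H. H \<in> F \<Longrightarrow> affine H \<and> aff_dim H \<le> k"
    "{p \<in> S. local_dim S p \<le> k} \<subseteq> \<Union>F" using minimal_cover[of k] by blast
  have "H \<in> F" if ord: "ordinary_flat S H" and dimH: "aff_dim H = k" for H
  proof -
    obtain U where H: "affine H" and U: "open U" "H \<inter> U \<noteq> {}" "S \<inter> U = H \<inter> U"
      using ord by (auto simp: ordinary_flat_def)
    have "H \<inter> U \<subseteq> \<Union>F"
    proof
      fix p assume p: "p \<in> H \<inter> U"
      then have "p \<in> S" using U(3) by blast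
      then show "p \<in> \<Union>F" using F(3) local_dim_flat[OF H U(1,3) p] dimH by auto
    qed
    then obtain A where A: "A \<in> F" "H \<subseteq> A"
      using flat_subset_of_local_cover[of F H U] F H U by blast
    have "H = A"
      using A U F(2)[OF A(1)] H aff_dim_subset[OF A(2)] dimH by (intro affine_dim_equal) auto
    then show ?thesis using A by simp
  qed
  then show ?thesis using F(1) by (auto intro: finite_subset)
qed

lemma ordinary_finite: "finite {H. ordinary_flat S H}"
proof -
  have "{H. ordinary_flat S H} \<subseteq> (\<Union>k\<in>{-1..int DIM('a)}. {H. ordinary_flat S H \<and> aff_dim H = k})"
    using aff_dim_le_DIM aff_dim_geq by auto
  then show ?thesis using ordinary_of_dim_finite by (auto intro: finite_subset)
qed

text \<open>
  Every neighbourhood of \<open>p\<close> in \<open>S\<close> contains convex pieces of the maximal dimension, all of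
  whose points have local dimension at most \<open>local_dim S p\<close>. Each piece lies in one flat of a finite
  cover, so one flat occurs for arbitrarily small neighbourhoods and therefore passes through \<open>p\<close>.
\<close>

lemma ordinary_covers:
  assumes p: "p \<in> S"
  shows "\<exists>H. ordinary_flat S H \<and> p \<in> H \<and> aff_dim H = local_dim S p"
proof -
  define k where "k = local_dim S p"
  obtain F where F: "finite F" "\<And>H. H \<in> F \<Longrightarrow> affine H \<and> aff_dim H \<le> k"
    "{p \<in> S. local_dim S p \<le> k} \<subseteq> \<Union>F" using minimal_cover[of k] by blast
  obtain e where e: "e > 0" "flat_dim (S \<inter> ball p e) = k"
    unfolding k_def by (rule local_dim_attained)
  have local_le: "local_dim S q \<le> k" if q: "q \<in> ball p e" for q
  proof -
    obtain d where d: "d > 0" "ball q d \<subseteq> ball p e"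
      using q by (meson open_contains_ball open_ball)
    have "local_dim S q \<le> flat_dim (S \<inter> ball q d)" using d by (intro local_dim_le)
    also have "\<dots> \<le> flat_dim (S \<inter> ball p e)" using d by (intro flat_dim_mono) auto
    finally show ?thesis using e by simp
  qed
  have k0: "k \<ge> 0"
  proof -
    have "aff_dim {p} \<le> flat_dim (S \<inter> ball p e)" using p e by (intro aff_dim_le_flat_dim) auto
    then show ?thesis using e by simp
  qed
  have piece: "\<exists>C. convex C \<and> C \<noteq> {} \<and> C \<subseteq> S \<inter> ball p d \<and> affine hull C \<in> F \<and> aff_dim C = k"
    if d: "0 < d" "d \<le> e" for d
  proof -
    obtain C where C: "convex C" "C \<subseteq> S \<inter> ball p d" "aff_dim C = flat_dim (S \<inter> ball p d)"
      by (rule flat_dim_attained)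
    have "flat_dim (S \<inter> ball p d) \<le> flat_dim (S \<inter> ball p e)"
      using d by (intro flat_dim_mono) auto
    then have "flat_dim (S \<inter> ball p d) = k"
      using local_dim_le[OF d(1), of S p] e by (simp add: k_def)
    then have Ck: "aff_dim C = k" using C by simp
    have "C \<noteq> {}" using Ck k0 by auto
    moreover have "C \<subseteq> \<Union>F"
    proof
      fix x assume "x \<in> C"
      then have "x \<in> S" "x \<in> ball p e" using C(2) d by auto
      then show "x \<in> \<Union>F" using local_le[of x] F(3) by blast
    qed
    ultimately have "affine hull C \<in> F"
      using aff_dim_eq_of_finite_cover[OF F(1,2) C(1)] Ck by auto
    then show ?thesis using C Ck \<open>C \<noteq> {}\<close> by blast
  qed
  define G where "G = {H \<in> F. \<exists>C. convex C \<and> C \<noteq> {} \<and> C \<subseteq> S \<inter> ball p e \<and> affine hull C = H \<and> aff_dim C = k}"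
  have finG: "finite G" using F(1) by (simp add: G_def)
  have "\<exists>H\<in>G. p \<in> H"
  proof (rule ccontr)
    assume no: "\<not> (\<exists>H\<in>G. p \<in> H)"
    have "open (- \<Union>G)"
      using finG F(2) by (intro open_Compl closed_Union ballI affine_closed) (auto simp: G_def)
    then obtain d where d: "d > 0" "ball p d \<subseteq> - \<Union>G"
      using no by (meson ComplI UnionE open_contains_ball)
    obtain C where C: "convex C" "C \<noteq> {}" "C \<subseteq> S \<inter> ball p (min d e)" "affine hull C \<in> F" "aff_dim C = k"
      using piece[of "min d e"] d e by auto
    have "C \<subseteq> S \<inter> ball p e" using C(3) by auto
    then have "affine hull C \<in> G" using C by (auto simp: G_def)
    moreover obtain c where "c \<in> C" using C(2) by auto
    moreover have "c \<in> affine hull C" using \<open>c \<in> C\<close> by (rule hull_inc)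
    moreover have "c \<in> ball p d" using C(3) \<open>c \<in> C\<close> by auto
    ultimately show False using d(2) by blast
  qed
  then obtain H C where H: "H \<in> F" "p \<in> H" and
    C: "convex C" "C \<noteq> {}" "C \<subseteq> S \<inter> ball p e" "affine hull C = H" "aff_dim C = k"
    by (auto simp: G_def)
  have affH: "affine H" and dimH: "aff_dim H = k"
    using F(2)[OF H(1)] C(4,5) by auto
  have "rel_interior C \<noteq> {}" using C by (simp add: rel_interior_eq_empty)
  \<comment> \<open>A relative interior point of \<open>C\<close> outside the other flats of
    \<open>F\<close> has a neighbourhood where \<open>S\<close> coincides with \<open>H\<close>:
    there \<open>S\<close> lies in \<open>\<Union>F\<close>, hence in \<open>H\<close>, and
    \<open>C\<close> fills \<open>H\<close>.\<close>
  have notcov: "\<not> rel_interior C \<subseteq> \<Union>(F - {H})"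
  proof
    assume "rel_interior C \<subseteq> \<Union>(F - {H})"
    then obtain A where A: "A \<in> F - {H}" "rel_interior C \<subseteq> A"
      using convex_subset_Union_affine[of "F - {H}" "rel_interior C"] F C(1)
        \<open>rel_interior C \<noteq> {}\<close> convex_rel_interior[OF C(1)] by auto
    have "H = affine hull (rel_interior C)"
      using C by (simp add: rel_interior_same_affine_hull)
    then have "H \<subseteq> A" using A F(2) by (simp add: hull_minimal)
    then have "H = A"
      using A F(2)[of A] affH dimH C(2) C(4) hull_subset[of C affine] aff_dim_subset[of H A]
      by (intro affine_dim_equal) auto
    then show False using A by blast
  qed
  then obtain q where q: "q \<in> rel_interior C" "q \<notin> \<Union>(F - {H})" by blast
  then obtain r where r: "r > 0" "ball q r \<inter> H \<subseteq> C" "q \<in> C"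
    unfolding mem_rel_interior_ball C(4) by auto
  define U where "U = ball q r \<inter> ball p e \<inter> - \<Union>(F - {H})"
  have "open (- \<Union>(F - {H}))"
    using F by (intro open_Compl closed_Union ballI affine_closed) auto
  then have "open U" by (simp add: U_def open_Int)
  moreover have "q \<in> H \<inter> U"
    using q r C(3) hull_inc[of q C affine] C(4) by (auto simp: U_def)
  moreover have "S \<inter> U = H \<inter> U"
  proof
    show "H \<inter> U \<subseteq> S \<inter> U" using r(2) C(3) by (auto simp: U_def)
    show "S \<inter> U \<subseteq> H \<inter> U"
    proof
      fix x assume x: "x \<in> S \<inter> U"
      then have "x \<in> \<Union>F" using F(3) local_le[of x] by (auto simp: U_def)
      then show "x \<in> H \<inter> U" using x by (auto simp: U_def)
    qed
  qed
  ultimately have "ordinary_flat S H" using affH by (auto simp: ordinary_flat_def)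
  then show ?thesis using H(2) dimH k_def by blast
qed

text \<open>The ordinary flats cover \<open>S\<close> strongly and belong to every finite collection
  of flats that does. So they are the least such collection, and hence the only minimal one.\<close>

lemma strong_cover_iff: "strong_cover S \<C> \<longleftrightarrow> \<C> = {H. ordinary_flat S H}"
proof -
  let ?O = "{H. ordinary_flat S H}"
  have cov: "covers_strongly ?O S"
    using ordinary_covers by (auto simp: covers_strongly_def)
  have aff: "\<forall>H\<in>?O. affine H" by (auto simp: ordinary_flat_def)
  have sub: "?O \<subseteq> \<C>'" if "finite \<C>'" "\<forall>H\<in>\<C>'. affine H" "covers_strongly \<C>' S" for \<C>'
    using ordinary_flat_in_cover[OF _ that(1) _ that(3)] that(2) by auto
  show ?thesis
  proof
    assume "strong_cover S \<C>"
    then show "\<C> = ?O" using sub[of \<C>] cov by (auto simp: strong_cover_def)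
  next
    assume C: "\<C> = ?O"
    have "\<not> covers_strongly \<C>' S" if "\<C>' \<subset> ?O" for \<C>'
    proof
      assume "covers_strongly \<C>' S"
      moreover have "finite \<C>'" using that ordinary_finite finite_subset by blast
      moreover have "\<forall>H\<in>\<C>'. affine H" using that aff by auto
      ultimately show False using sub[of \<C>'] that by auto
    qed
    then show "strong_cover S \<C>"
      using C cov aff ordinary_finite by (auto simp: strong_cover_def)
  qed
qed

lemma nu_eq: "nu k S = card {H. ordinary_flat S H \<and> aff_dim H = k}"
proof -
  have "(THE \<C>. strong_cover S \<C>) = {H. ordinary_flat S H}"
    by (rule the_equality) (simp_all add: strong_cover_iff)
  then show ?thesis by (simp add: nu_def)
qed

end

section \<open>Ordinary hyperplanes and pairs of convex sets\<close>

text \<open>The nonempty interiors make the relation irreflexive and later hold the vertices of the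
  plane drawing. The set \<open>W\<close> pins down the hyperplane: it lies on every hyperplane that
  weakly separates the two sets.\<close>

definition touch_along :: "'a::euclidean_space set \<Rightarrow> 'a set \<Rightarrow> 'a set \<Rightarrow> bool" where
  "touch_along H A B \<longleftrightarrow> interior A \<noteq> {} \<and> interior B \<noteq> {} \<and>
     (\<exists>a b W. a \<noteq> 0 \<and> H = {x. a \<bullet> x = b} \<and> A \<subseteq> {x. b \<le> a \<bullet> x} \<and> B \<subseteq> {x. a \<bullet> x \<le> b} \<and>
        W \<subseteq> closure A \<inter> closure B \<and> affine hull W = H)"

lemma touch_along_sym:
  assumes "touch_along H A B" shows "touch_along H B A"
proof -
  obtain a b W where *: "a \<noteq> 0" "H = {x. a \<bullet> x = b}" "A \<subseteq> {x. b \<le> a \<bullet> x}" "B \<subseteq> {x. a \<bullet> x \<le> b}"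
    "W \<subseteq> closure A \<inter> closure B" "affine hull W = H" "interior A \<noteq> {}" "interior B \<noteq> {}"
    using assms by (auto simp: touch_along_def)
  show ?thesis unfolding touch_along_def
    by (intro conjI exI[of _ "- a"] exI[of _ "- b"] exI[of _ W]) (use * in auto)
qed

lemma touch_along_unique:
  assumes "touch_along H A B" "touch_along H' A B" shows "H = H'"
proof -
  obtain a b W where *: "a \<noteq> 0" "H = {x. a \<bullet> x = b}"
    "W \<subseteq> closure A \<inter> closure B" "affine hull W = H"
    using assms(1) by (auto simp: touch_along_def)
  obtain a' b' where **: "a' \<noteq> 0" "H' = {x. a' \<bullet> x = b'}" "A \<subseteq> {x. b' \<le> a' \<bullet> x}" "B \<subseteq> {x. a' \<bullet> x \<le> b'}"
    using assms(2) by (auto simp: touch_along_def)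
  have "closure A \<subseteq> {x. b' \<le> a' \<bullet> x}" "closure B \<subseteq> {x. a' \<bullet> x \<le> b'}"
    using ** by (simp_all add: closure_minimal closed_halfspace_ge closed_halfspace_le)
  then have "W \<subseteq> H'" using *(3) **(2) by fastforce
  then have "H \<subseteq> H'" using *(4) **(2) by (simp add: affine_hyperplane hull_minimal flip: *(4))
  moreover have "(b / (a \<bullet> a)) *\<^sub>R a \<in> H" using *(1,2) by simp
  then have "H \<noteq> {}" by blast
  ultimately show ?thesis
    using * ** by (intro affine_dim_equal) (auto simp: affine_hyperplane)
qed

lemma open_subset_halfspace_strict:
  fixes a :: "'a::euclidean_space"
  assumes "open T" "T \<subseteq> {x. b \<le> a \<bullet> x}" "a \<noteq> 0"
  shows "T \<subseteq> {x. b < a \<bullet> x}"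
  using interior_maximal[OF assms(2,1)] assms(3) by (simp add: interior_halfspace_ge)

lemma touch_along_interior:
  assumes "touch_along H A B"
  shows "interior A \<inter> interior B = {}" "interior A \<inter> H = {}" "interior B \<inter> H = {}"
proof -
  obtain a b where *: "a \<noteq> 0" "H = {x. a \<bullet> x = b}" "A \<subseteq> {x. b \<le> a \<bullet> x}" "B \<subseteq> {x. a \<bullet> x \<le> b}"
    using assms(1) by (auto simp: touch_along_def)
  have "interior A \<subseteq> {x. b < a \<bullet> x}"
    using * interior_subset by (intro open_subset_halfspace_strict) blast+
  moreover have "interior B \<subseteq> {x. - b < (- a) \<bullet> x}"
    using * interior_subset by (intro open_subset_halfspace_strict) fastforce+
  ultimately show "interior A \<inter> interior B = {}" "interior A \<inter> H = {}" "interior B \<inter> H = {}"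
    using *(2) by fastforce+
qed

lemma touch_along_distinct: "\<not> touch_along H A A"
  using touch_along_interior(1)[of H A A] by (auto simp: touch_along_def)

section \<open>From an ordinary hyperplane to a touching pair\<close>

context convex_cover
begin

text \<open>\<open>K i\<close> misses the hyperplane inside \<open>U\<close>, because
  \<open>S\<close> contains it there. A point of \<open>K i\<close> below the hyperplane, joined to
  a point of \<open>W\<close>, would give points of \<open>K i\<close> in \<open>U\<close> on both
  sides, and the segment between two of them would cross. The interior is nonempty because
  \<open>W\<close> spans the hyperplane and \<open>K i\<close> has a point off it.\<close>

lemma ordinary_hyperplane_one_side:
  assumes i: "i \<in> I" and a: "a \<noteq> 0" and U: "open U" "convex U" "S \<inter> U = {x. a \<bullet> x = b} \<inter> U"
    and W: "W \<subseteq> {x. a \<bullet> x = b} \<inter> U \<inter> closure (K i \<inter> {x. b < a \<bullet> x} \<inter> U)" "W \<noteq> {}"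
    and hullW: "affine hull W = {x. a \<bullet> x = b}"
  shows "K i \<subseteq> {x. b \<le> a \<bullet> x}" "interior (K i) \<noteq> {}" "W \<subseteq> closure (K i)"
proof -
  have cK: "convex (K i)" using i by (rule convex_K)
  show WK: "W \<subseteq> closure (K i)"
    using W(1) closure_mono[of "K i \<inter> {x. b < a \<bullet> x} \<inter> U" "K i"] by auto
  have "K i \<inter> {x. b < a \<bullet> x} \<inter> U \<noteq> {}" using W by auto
  then obtain y where y: "y \<in> K i" "b < a \<bullet> y" "y \<in> U" by blast
  obtain q where q: "q \<in> W" using W by auto
  then have qU: "q \<in> U" "a \<bullet> q = b" "q \<in> closure (K i)" using W(1) WK by auto
  show "K i \<subseteq> {x. b \<le> a \<bullet> x}"
  proof (rule ccontr)
    assume "\<not> K i \<subseteq> {x. b \<le> a \<bullet> x}"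
    then obtain w where w: "w \<in> K i" "a \<bullet> w < b" by force
    obtain r where r: "r > 0" "ball q r \<subseteq> U" using qU U(1) by (meson open_contains_ball)
    \<comment> \<open>Small enough that the step from \<open>q\<close> towards \<open>w\<close>
      stays in \<open>ball q r\<close>; the added 1 keeps the denominator positive.\<close>
    define s where "s = min 1 (r / (2 * (norm (w - q) + 1)))"
    have s: "0 < s" "s \<le> 1" using r by (auto simp: s_def add_nonneg_pos)
    have "s * norm (w - q) \<le> s * (norm (w - q) + 1)" using s by simp
    also have "\<dots> \<le> r / (2 * (norm (w - q) + 1)) * (norm (w - q) + 1)"
      by (intro mult_right_mono) (auto simp: s_def)
    also have "\<dots> = r / 2"
      using add_nonneg_pos[OF norm_ge_zero zero_less_one, of "w - q"] by (simp add: field_simps)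
    finally have sr: "s * norm (w - q) < r" using r by simp
    define x where "x = (1 - s) *\<^sub>R q + s *\<^sub>R w"
    have "x = q + s *\<^sub>R (w - q)" by (simp add: x_def algebra_simps)
    then have "dist q x = s * norm (w - q)" using s by (simp add: dist_norm)
    then have xU: "x \<in> U" using sr r by auto
    have "a \<bullet> x = b - s * (b - a \<bullet> w)" using qU by (simp add: x_def inner_simps algebra_simps)
    also have "\<dots> < b" using s w by simp
    finally have xb: "a \<bullet> x < b" .
    have "x \<in> closure (K i)"
      unfolding x_def using cK qU w closure_subset s
      by (intro convexD[OF convex_closure]) auto
    then have "U \<inter> {x. a \<bullet> x < b} \<inter> closure (K i) \<noteq> {}" using xU xb by auto
    then have "U \<inter> {x. a \<bullet> x < b} \<inter> K i \<noteq> {}"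
      using open_Int_closure_eq_empty[of "U \<inter> {x. a \<bullet> x < b}" "K i"] U(1)
      by (simp add: open_Int open_halfspace_lt)
    then obtain z where z: "z \<in> U \<inter> K i" "a \<bullet> z \<le> b" by force
    have "connected (U \<inter> K i)" using cK U(2) by (simp add: convex_Int convex_connected)
    then obtain v where "v \<in> U \<inter> K i" "a \<bullet> v = b"
      using connected_ivt_hyperplane[of "U \<inter> K i" z y a b] z y by auto
    then show False using U(3) S_eq i by auto
  qed
  have "y \<notin> affine hull W" using y hullW by simp
  then have "aff_dim (insert y W) = aff_dim W + 1" by (simp add: aff_dim_insert)
  also have "aff_dim W = int DIM('a) - 1"
    using a hullW aff_dim_hyperplane[of a b] aff_dim_affine_hull[of W] DIM_positive[where 'a='a] by simp
  finally have "aff_dim (insert y W) = int DIM('a)" by simp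
  moreover have "insert y W \<subseteq> closure (K i)" using WK y closure_subset by auto
  ultimately have "aff_dim (closure (K i)) = int DIM('a)"
    using aff_dim_subset aff_dim_le_DIM by (metis antisym)
  then have "affine hull (K i) = UNIV" using aff_dim_eq_full[of "closure (K i)"] by simp
  then have "rel_interior (K i) = interior (K i)" by (rule rel_interior_interior)
  then show "interior (K i) \<noteq> {}" using rel_interior_eq_empty[OF cK] y by auto
qed

text \<open>Inside \<open>U\<close> the open side is covered by the \<open>K i\<close>, and closure
  commutes with finite unions.\<close>

lemma closure_side_subset:
  assumes a: "a \<noteq> 0" and U: "open U" "S \<inter> U = {x. a \<bullet> x = b} \<inter> U"
  shows "{x. a \<bullet> x = b} \<inter> U \<subseteq> (\<Union>i\<in>I. closure (K i \<inter> {x. b < a \<bullet> x} \<inter> U))"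
proof
  fix q assume q: "q \<in> {x. a \<bullet> x = b} \<inter> U"
  have "{x. b < a \<bullet> x} \<inter> U \<subseteq> (\<Union>i\<in>I. K i)" using U(2) S_eq by auto
  then have eq: "{x. b < a \<bullet> x} \<inter> U = (\<Union>i\<in>I. K i \<inter> {x. b < a \<bullet> x} \<inter> U)" by auto
  have "q \<in> closure {x. b < a \<bullet> x}" using q a by (simp add: closure_halfspace_gt)
  then have "q \<in> closure ({x. b < a \<bullet> x} \<inter> U)"
    using q open_Int_closure_subset[OF U(1), of "{x. b < a \<bullet> x}"] by (auto simp: Int_commute)
  also have "closure ({x. b < a \<bullet> x} \<inter> U) = (\<Union>i\<in>I. closure (K i \<inter> {x. b < a \<bullet> x} \<inter> U))"
    by (subst eq) (use finite_I in \<open>induction rule: finite_induct; simp\<close>)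
  finally show "q \<in> (\<Union>i\<in>I. closure (K i \<inter> {x. b < a \<bullet> x} \<inter> U))" .
qed

lemma ordinary_hyperplane_touch:
  assumes "ordinary_flat S H" "aff_dim H = int DIM('a) - 1"
  obtains i j where "i \<in> I" "j \<in> I" "touch_along H (K i) (K j)"
proof -
  obtain V where H: "affine H" and V: "open V" "H \<inter> V \<noteq> {}" "S \<inter> V = H \<inter> V"
    using assms(1) by (auto simp: ordinary_flat_def)
  obtain a b where ab: "a \<noteq> 0" "H = {x. a \<bullet> x = b}"
    using aff_dim_eq_hyperplane[of H] assms(2) hull_same[of affine H] H by auto
  obtain p where p: "p \<in> H" "p \<in> V" using V by auto
  then obtain r where r: "r > 0" "ball p r \<subseteq> V" using V by (meson open_contains_ball)
  define U where "U = ball p r"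
  have U: "open U" "convex U" "S \<inter> U = {x. a \<bullet> x = b} \<inter> U" "p \<in> U"
    using V r ab by (auto simp: U_def)
  have U': "S \<inter> U = {x. (- a) \<bullet> x = - b} \<inter> U" using U(3) by simp
  have Heq: "{x. (- a) \<bullet> x = - b} = H" using ab by simp
  \<comment> \<open>\<open>W (i, j)\<close> collects the points approached by \<open>K i\<close>
    from above and by \<open>K j\<close> from below. Finitely many affine hulls of these sets cover
    \<open>H \<inter> U\<close>, so one of them is all of \<open>H\<close>. The lower side is the
    upper side for \<open>- a\<close> and \<open>- b\<close>.\<close>
  define W where "W = (\<lambda>(i, j). H \<inter> U \<inter> closure (K i \<inter> {x. b < a \<bullet> x} \<inter> U)
     \<inter> closure (K j \<inter> {x. - b < (- a) \<bullet> x} \<inter> U))"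
  have "H \<inter> U \<subseteq> \<Union>((\<lambda>e. affine hull W e) ` (I \<times> I))"
  proof
    fix q assume q: "q \<in> H \<inter> U"
    obtain i where "i \<in> I" "q \<in> closure (K i \<inter> {x. b < a \<bullet> x} \<inter> U)"
      using closure_side_subset[OF ab(1) U(1,3)] q ab(2) by blast
    moreover obtain j where "j \<in> I" "q \<in> closure (K j \<inter> {x. - b < (- a) \<bullet> x} \<inter> U)"
      using closure_side_subset[of "- a", OF _ U(1) U'] q ab(1) Heq by auto
    ultimately have "(i, j) \<in> I \<times> I" "q \<in> W (i, j)" using q by (auto simp: W_def)
    then show "q \<in> \<Union>((\<lambda>e. affine hull W e) ` (I \<times> I))" by (meson UN_I hull_inc)
  qed
  then have "\<exists>A\<in>(\<lambda>e. affine hull W e) ` (I \<times> I). H \<subseteq> A"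
    using finite_I H U p by (intro flat_subset_of_local_cover[where U = U]) auto
  then obtain i j where ij: "i \<in> I" "j \<in> I" "H \<subseteq> affine hull W (i, j)" by auto
  have "W (i, j) \<subseteq> H" by (auto simp: W_def)
  then have hullW: "affine hull W (i, j) = H" using ij(3) H by (simp add: hull_minimal subset_antisym)
  then have ne: "W (i, j) \<noteq> {}" using p by auto
  have "W (i, j) \<subseteq> {x. a \<bullet> x = b} \<inter> U \<inter> closure (K i \<inter> {x. b < a \<bullet> x} \<inter> U)"
    using ab by (auto simp: W_def)
  note 1 = ordinary_hyperplane_one_side[OF ij(1) ab(1) U(1-3) this ne, unfolded hullW, OF ab(2)]
  have "W (i, j) \<subseteq> {x. (- a) \<bullet> x = - b} \<inter> U \<inter> closure (K j \<inter> {x. - b < (- a) \<bullet> x} \<inter> U)"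
    unfolding Heq by (auto simp: W_def)
  note 2 = ordinary_hyperplane_one_side[OF ij(2) _ U(1,2) U' this ne, unfolded hullW, OF _ Heq[symmetric]]
  have "touch_along H (K i) (K j)"
    unfolding touch_along_def using 1 2 ab hullW
    by (intro conjI exI[of _ a] exI[of _ b] exI[of _ "W (i, j)"]) auto
  with ij(1,2) show ?thesis by (rule that)
qed

definition touching_pairs :: "'i set set" where
  "touching_pairs = {{i, j} |i j. i \<in> I \<and> j \<in> I \<and> (\<exists>H. touch_along H (K i) (K j))}"

lemma touching_pairs_subset: "touching_pairs \<subseteq> nsets I 2"
  using touch_along_distinct by (fastforce simp: touching_pairs_def nsets_2_eq)

text \<open>Choosing a touching pair for each ordinary hyperplane is injective by
  \<open>touch_along_unique\<close>.\<close>

lemma nu_hyperplanes_le: "nu (int DIM('a) - 1) S \<le> card touching_pairs"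
proof -
  let ?O = "{H. ordinary_flat S H \<and> aff_dim H = int DIM('a) - 1}"
  define f where "f H = (SOME e. \<exists>i j. e = {i, j} \<and> i \<in> I \<and> j \<in> I \<and> touch_along H (K i) (K j))" for H
  have f: "\<exists>i j. f H = {i, j} \<and> i \<in> I \<and> j \<in> I \<and> touch_along H (K i) (K j)" if H: "H \<in> ?O" for H
  proof -
    obtain i j where "i \<in> I" "j \<in> I" "touch_along H (K i) (K j)"
      by (rule ordinary_hyperplane_touch[of H]) (use H in auto)
    then have "\<exists>e i j. e = {i, j} \<and> i \<in> I \<and> j \<in> I \<and> touch_along H (K i) (K j)" by blast
    then show ?thesis unfolding f_def by (rule someI_ex)
  qed
  have "inj_on f ?O"
  proof
    fix H H' assume "H \<in> ?O" "H' \<in> ?O" and eq: "f H = f H'"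
    then obtain i j i' j' where *: "f H = {i, j}" "touch_along H (K i) (K j)"
      "f H' = {i', j'}" "touch_along H' (K i') (K j')" using f by meson
    then have "i = i' \<and> j = j' \<or> i = j' \<and> j = i'" using eq by (auto simp: doubleton_eq_iff)
    then have "touch_along H' (K i) (K j)" using * touch_along_sym by blast
    then show "H = H'" using * touch_along_unique by blast
  qed
  moreover have "f ` ?O \<subseteq> touching_pairs"
    using f by (fastforce simp: touching_pairs_def)
  moreover have "finite touching_pairs"
    using touching_pairs_subset finite_imp_finite_nsets[OF finite_I] finite_subset by blast
  ultimately show ?thesis unfolding nu_eq by (simp add: card_inj_on_le)
qed

end

section \<open>Non-planarity of the complete graph on five vertices\<close>

text \<open>Each edge is parametrized in both directions so that arcs can be joined in any order;
  only the images of the two directions have to agree.\<close>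

locale arc_drawing =
  fixes V :: "'v set" and v :: "'v \<Rightarrow> complex" and g :: "'v \<Rightarrow> 'v \<Rightarrow> real \<Rightarrow> complex"
  assumes arc_g: "\<lbrakk>i \<in> V; j \<in> V; i \<noteq> j\<rbrakk> \<Longrightarrow> arc (g i j)"
    and start_g: "\<lbrakk>i \<in> V; j \<in> V; i \<noteq> j\<rbrakk> \<Longrightarrow> pathstart (g i j) = v i"
    and finish_g: "\<lbrakk>i \<in> V; j \<in> V; i \<noteq> j\<rbrakk> \<Longrightarrow> pathfinish (g i j) = v j"
    and image_sym: "\<lbrakk>i \<in> V; j \<in> V; i \<noteq> j\<rbrakk> \<Longrightarrow> path_image (g i j) = path_image (g j i)"
    and image_disjoint: "\<lbrakk>i \<in> V; j \<in> V; k \<in> V; l \<in> V; i \<noteq> j; k \<noteq> l; i \<noteq> k; i \<noteq> l; j \<noteq> k; j \<noteq> l\<rbrakk>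
       \<Longrightarrow> path_image (g i j) \<inter> path_image (g k l) = {}"
    and image_adjacent: "\<lbrakk>i \<in> V; j \<in> V; k \<in> V; i \<noteq> j; i \<noteq> k; j \<noteq> k\<rbrakk>
       \<Longrightarrow> path_image (g i j) \<inter> path_image (g i k) = {v i}"
begin

section \<open>Triangles of the drawing as Jordan curves\<close>

abbreviation P where "P i j \<equiv> path_image (g i j)"

abbreviation T where "T a b c \<equiv> P a b \<union> P b c \<union> P a c"

lemma vertex_in_image:
  assumes "i \<in> V" "j \<in> V" "i \<noteq> j"
  shows "v i \<in> P i j" "v j \<in> P i j"
  using assms start_g finish_g pathstart_in_path_image pathfinish_in_path_image by metis+

lemma image_adjacent':
  assumes "i \<in> V" "j \<in> V" "k \<in> V" "i \<noteq> j" "i \<noteq> k" "j \<noteq> k"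
  shows "P i j \<inter> P k i = {v i}" "P j i \<inter> P i k = {v i}" "P j i \<inter> P k i = {v i}"
  using image_adjacent[OF assms] image_sym assms by metis+

lemma two_arc:
  assumes "i \<in> V" "j \<in> V" "k \<in> V" "i \<noteq> j" "j \<noteq> k" "i \<noteq> k"
  shows "arc (g i j +++ g j k)" "pathstart (g i j +++ g j k) = v i"
    "pathfinish (g i j +++ g j k) = v k" "path_image (g i j +++ g j k) = P i j \<union> P j k"
  using assms arc_g start_g finish_g image_adjacent'
  by (auto simp: arc_join_eq path_image_join)

lemma simple_triangle:
  assumes "a \<in> V" "b \<in> V" "c \<in> V" "a \<noteq> b" "b \<noteq> c" "a \<noteq> c"
  obtains p where "simple_path p" "pathfinish p = pathstart p" "path_image p = T a b c"
proof
  let ?p = "g a b +++ g b c +++ g c a"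
  note bc = two_arc[of b c a]
  show "simple_path ?p"
  proof (subst simple_path_join_loop_eq)
    show "arc (g a b) \<and> arc (g b c +++ g c a) \<and>
      P a b \<inter> path_image (g b c +++ g c a) \<subseteq> {pathstart (g a b), pathstart (g b c +++ g c a)}"
      using assms arc_g[of a b] bc start_g[of a b] image_adjacent'[of b a c] image_adjacent'[of a b c]
      by auto
  qed (use assms bc start_g finish_g in auto)
  show "pathfinish ?p = pathstart ?p" using assms start_g finish_g by simp
  show "path_image ?p = T a b c"
    using assms bc start_g finish_g image_sym by (auto simp: path_image_join)
qed

lemma triangle_jordan:
  assumes "a \<in> V" "b \<in> V" "c \<in> V" "a \<noteq> b" "b \<noteq> c" "a \<noteq> c"
  shows "open (inside (T a b c))" "open (outside (T a b c))"
    "inside (T a b c) \<inter> outside (T a b c) = {}" "inside (T a b c) \<union> outside (T a b c) = - T a b c"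
    "frontier (inside (T a b c)) = T a b c" "inside (T a b c) \<noteq> {}"
    "connected (outside (T a b c))" "bounded (inside (T a b c))"
proof -
  obtain p where p: "simple_path p" "pathfinish p = pathstart p" "path_image p = T a b c"
    using simple_triangle[OF assms] by blast
  show "open (inside (T a b c))" "open (outside (T a b c))"
    "inside (T a b c) \<inter> outside (T a b c) = {}" "inside (T a b c) \<union> outside (T a b c) = - T a b c"
    "frontier (inside (T a b c)) = T a b c" "inside (T a b c) \<noteq> {}"
    "connected (outside (T a b c))" "bounded (inside (T a b c))"
    using Jordan_inside_outside[OF p(1,2)] unfolding p(3) by blast+
qed

lemma connected_same_side:
  assumes "a \<in> V" "b \<in> V" "c \<in> V" "a \<noteq> b" "b \<noteq> c" "a \<noteq> c"
    and C: "connected C" "C \<inter> T a b c = {}"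
  shows "C \<subseteq> inside (T a b c) \<or> C \<subseteq> outside (T a b c)"
proof -
  note J = triangle_jordan[OF assms(1-6)]
  have "C \<subseteq> inside (T a b c) \<union> outside (T a b c)" using C(2) J(4) by blast
  then show ?thesis
    using connectedD[OF C(1) J(1,2)] J(3) by blast
qed

lemma edge_same_side:
  assumes "a \<in> V" "b \<in> V" "c \<in> V" "d \<in> V" "e \<in> V" "distinct [a, b, c, d, e]"
  shows "P d e \<subseteq> inside (T a b c) \<or> P d e \<subseteq> outside (T a b c)"
proof (rule connected_same_side)
  show "connected (P d e)" using assms arc_g by (auto intro!: connected_path_image arc_imp_path)
  show "P d e \<inter> T a b c = {}"
    using image_disjoint[of d e a b] image_disjoint[of d e b c] image_disjoint[of d e a c] assms
    by auto
qed (use assms in auto)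

text \<open>A connected set with more than one point has no isolated points, and deleting finitely
  many points does not affect limit points.\<close>

lemma closure_open_edge:
  assumes "i \<in> V" "j \<in> V" "i \<noteq> j"
  shows "v i \<in> closure (P i j - {v i, v j})" "v j \<in> closure (P i j - {v i, v j})"
proof -
  let ?E = "P i j - {v i, v j}"
  have conn: "connected (P i j)" using assms arc_g by (auto intro!: connected_path_image arc_imp_path)
  have in_ij: "v i \<in> P i j" "v j \<in> P i j" "v i \<noteq> v j"
    using vertex_in_image[of i j] assms arc_distinct_ends[OF arc_g[of i j]] start_g[of i j] finish_g[of i j]
    by auto
  have "x \<in> closure ?E" if "x \<in> P i j" for x
  proof -
    have "P i j \<noteq> {y}" for y using in_ij by auto
    then have "x islimpt P i j"
      using connected_imp_perfect[OF conn that] by blast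
    moreover have "P i j = ?E \<union> (P i j \<inter> {v i, v j})" by blast
    moreover have "\<not> x islimpt (P i j \<inter> {v i, v j})" by (rule islimpt_finite) simp
    ultimately have "x islimpt ?E" by (metis islimpt_Un)
    then show ?thesis by (simp add: closure_def)
  qed
  then show "v i \<in> closure ?E" "v j \<in> closure ?E" using in_ij by auto
qed

text \<open>The edge without its ends is connected and misses the triangle, so it stays on one side.
  It accumulates at \<open>v d\<close>, which selects the side of \<open>v d\<close>.\<close>

lemma open_edge_same_side:
  assumes V: "a \<in> V" "b \<in> V" "c \<in> V" "d \<in> V" and dist: "distinct [a, b, c, d]"
  shows "v d \<in> inside (T a b c) \<Longrightarrow> P c d - {v c, v d} \<subseteq> inside (T a b c)"
    "v d \<in> outside (T a b c) \<Longrightarrow> P c d - {v c, v d} \<subseteq> outside (T a b c)"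
proof -
  let ?E = "P c d - {v c, v d}"
  have dd: "a \<noteq> b" "a \<noteq> c" "a \<noteq> d" "b \<noteq> c" "b \<noteq> d" "c \<noteq> d"
    "b \<noteq> a" "c \<noteq> a" "d \<noteq> a" "c \<noteq> b" "d \<noteq> b" "d \<noteq> c" using dist by auto
  note J = triangle_jordan[OF V(1-3) dd(1,4,2)]
  have Econn: "connected ?E"
    using connected_simple_path_endless[of "g c d"] arc_imp_simple_path[OF arc_g[of c d]]
      start_g[of c d] finish_g[of c d] V dd by auto
  have "P c d \<inter> P a b = {}" "P c d \<inter> P b c = {v c}" "P c d \<inter> P a c = {v c}"
    by (simp_all add: image_adjacent image_adjacent' image_disjoint V dd)
  then have "?E \<inter> T a b c = {}" by blast
  note side = connected_same_side[OF V(1-3) dd(1,4,2) Econn this]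
  have cl: "v d \<in> closure ?E" using closure_open_edge V dd by blast
  show "?E \<subseteq> inside (T a b c)" if "v d \<in> inside (T a b c)"
  proof -
    have "?E \<inter> inside (T a b c) \<noteq> {}"
      using cl that J(1) open_Int_closure_eq_empty[of "inside (T a b c)" ?E] by blast
    then show ?thesis using side J(3) by blast
  qed
  show "?E \<subseteq> outside (T a b c)" if "v d \<in> outside (T a b c)"
  proof -
    have "?E \<inter> outside (T a b c) \<noteq> {}"
      using cl that J(2) open_Int_closure_eq_empty[of "outside (T a b c)" ?E] by blast
    then show ?thesis using side J(3) by blast
  qed
qed

text \<open>
  The triangle \<open>abc\<close> and the path through an inner vertex \<open>d\<close> form a theta graph.
\<close>

lemma theta_triangle:
  assumes V: "a \<in> V" "b \<in> V" "c \<in> V" "d \<in> V" and dist: "distinct [a, b, c, d]"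
    and d: "v d \<in> inside (T a b c)"
  shows "inside (T a b d) \<union> inside (P a c \<union> P b c \<union> P a d \<union> P b d) \<union>
    (P a d \<union> P b d - {v a, v b}) = inside (T a b c)"
proof -
  have dd: "a \<noteq> b" "a \<noteq> c" "a \<noteq> d" "b \<noteq> c" "b \<noteq> d" "c \<noteq> d"
    "b \<noteq> a" "c \<noteq> a" "d \<noteq> a" "c \<noteq> b" "d \<noteq> b" "d \<noteq> c" using dist by auto
  have sy: "P c b = P b c" "P d b = P b d" using image_sym V dd by auto
  note acb = two_arc[OF V(1,3,2) dd(2,10,1)] note adb = two_arc[OF V(1,4,2) dd(3,11,1)]
  have Tabc: "P a b \<union> (P a c \<union> P c b) = T a b c" using sy by auto
  have Tabd: "P a b \<union> (P a d \<union> P d b) = T a b d" using sy by auto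
  have vne: "v a \<noteq> v b" using arc_g[of a b] start_g[of a b] finish_g[of a b] V dd arc_distinct_ends by metis
  have "v a \<in> P a b" "v b \<in> P a b" "v a \<in> P a c" "v b \<in> P b c" "v a \<in> P a d" "v b \<in> P b d" "v d \<in> P a d"
    using vertex_in_image V dd by blast+
  note ends = this
  have f: "P a c \<inter> P a d = {v a}" "P b c \<inter> P b d = {v b}" "P a c \<inter> P b d = {}" "P b c \<inter> P a d = {}"
    "P a b \<inter> P a c = {v a}" "P a b \<inter> P b c = {v b}" "P a b \<inter> P a d = {v a}" "P a b \<inter> P b d = {v b}"
    by (simp_all add: image_adjacent image_adjacent' image_disjoint V dd)
  have i1: "P a b \<inter> path_image (g a c +++ g c b) = {v a, v b}"
    unfolding acb(4) by (auto simp: Int_Un_distrib Int_Un_distrib2 f sy)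
  have i2: "P a b \<inter> path_image (g a d +++ g d b) = {v a, v b}"
    unfolding adb(4) by (auto simp: Int_Un_distrib Int_Un_distrib2 f sy)
  have i3: "path_image (g a c +++ g c b) \<inter> path_image (g a d +++ g d b) = {v a, v b}"
    unfolding acb(4) adb(4)
    by (auto simp: Int_Un_distrib Int_Un_distrib2 f sy)
  have ne: "path_image (g a d +++ g d b) \<inter> inside (P a b \<union> path_image (g a c +++ g c b)) \<noteq> {}"
    unfolding acb(4) adb(4) Tabc using d ends by blast
  have sab: "simple_path (g a b)" using arc_g V dd by (simp add: arc_imp_simple_path)
  have "inside (P a b \<union> path_image (g a d +++ g d b)) \<union>
      inside (path_image (g a c +++ g c b) \<union> path_image (g a d +++ g d b)) \<union>
      (path_image (g a d +++ g d b) - {v a, v b}) = inside (P a b \<union> path_image (g a c +++ g c b))"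
    by (rule split_inside_simple_closed_curve[OF sab start_g[OF V(1,2) dd(1)] finish_g[OF V(1,2) dd(1)]
          arc_imp_simple_path[OF acb(1)] acb(2,3) arc_imp_simple_path[OF adb(1)] adb(2,3) vne i1 i2 i3 ne])
  then show ?thesis unfolding acb(4) adb(4) Tabc Tabd sy by (simp add: Un_ac)
qed

text \<open>Here the theta graph consists of the two paths from \<open>c\<close> to \<open>d\<close>
  through \<open>a\<close> and through \<open>b\<close>, with the edge \<open>cd\<close> as the
  dividing chord.\<close>

lemma theta_quadrilateral:
  assumes V: "a \<in> V" "b \<in> V" "c \<in> V" "d \<in> V" and dist: "distinct [a, b, c, d]"
    and cd: "P c d \<inter> inside (P a c \<union> P b c \<union> P a d \<union> P b d) \<noteq> {}"
  shows "inside (T a c d) \<union> inside (T b c d) \<union> (P c d - {v c, v d}) =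
    inside (P a c \<union> P b c \<union> P a d \<union> P b d)"
proof -
  have dd: "a \<noteq> b" "a \<noteq> c" "a \<noteq> d" "b \<noteq> c" "b \<noteq> d" "c \<noteq> d"
    "b \<noteq> a" "c \<noteq> a" "d \<noteq> a" "c \<noteq> b" "d \<noteq> b" "d \<noteq> c" using dist by auto
  have sy: "P c b = P b c" "P c a = P a c" using image_sym V dd by auto
  note cad = two_arc[OF V(3,1,4) dd(8,3,6)] note cbd = two_arc[OF V(3,2,4) dd(10,5,6)]
  have vne: "v c \<noteq> v d" using arc_g[of c d] start_g[of c d] finish_g[of c d] V dd arc_distinct_ends by metis
  have "v c \<in> P c d" "v d \<in> P c d" "v c \<in> P a c" "v c \<in> P b c" "v d \<in> P a d" "v d \<in> P b d"
    using vertex_in_image V dd by blast+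
  note ends = this
  have f: "P a c \<inter> P b c = {v c}" "P a d \<inter> P b d = {v d}" "P a c \<inter> P b d = {}" "P a d \<inter> P b c = {}"
    "P a c \<inter> P c d = {v c}" "P a d \<inter> P c d = {v d}" "P b c \<inter> P c d = {v c}" "P b d \<inter> P c d = {v d}"
    by (simp_all add: image_adjacent image_adjacent' image_disjoint V dd)
  have i1: "path_image (g c a +++ g a d) \<inter> path_image (g c b +++ g b d) = {v c, v d}"
    unfolding cad(4) cbd(4)
    by (auto simp: Int_Un_distrib Int_Un_distrib2 f sy)
  have i2: "path_image (g c a +++ g a d) \<inter> P c d = {v c, v d}"
    unfolding cad(4) by (auto simp: Int_Un_distrib Int_Un_distrib2 f sy)
  have i3: "path_image (g c b +++ g b d) \<inter> P c d = {v c, v d}"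
    unfolding cbd(4) by (auto simp: Int_Un_distrib Int_Un_distrib2 f sy)
  have Q: "path_image (g c a +++ g a d) \<union> path_image (g c b +++ g b d) = P a c \<union> P b c \<union> P a d \<union> P b d"
    unfolding cad(4) cbd(4) sy by blast
  have scd: "simple_path (g c d)" using arc_g V dd by (simp add: arc_imp_simple_path)
  have "inside (path_image (g c a +++ g a d) \<union> P c d) \<union> inside (path_image (g c b +++ g b d) \<union> P c d) \<union>
      (P c d - {v c, v d}) = inside (path_image (g c a +++ g a d) \<union> path_image (g c b +++ g b d))"
    by (rule split_inside_simple_closed_curve[OF arc_imp_simple_path[OF cad(1)] cad(2,3)
          arc_imp_simple_path[OF cbd(1)] cbd(2,3) scd start_g[OF V(3,4) dd(6)] finish_g[OF V(3,4) dd(6)]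
          vne i1 i2 i3]) (use cd Q in simp)
  moreover have "path_image (g c a +++ g a d) \<union> P c d = T a c d" "path_image (g c b +++ g b d) \<union> P c d = T b c d"
    unfolding cad(4) cbd(4) sy by blast+
  ultimately show ?thesis unfolding Q by simp
qed

section \<open>Two vertices inside a triangle\<close>

lemma T_perm:
  assumes "a \<in> V" "b \<in> V" "c \<in> V" "a \<noteq> b" "b \<noteq> c" "a \<noteq> c"
  shows "T b a c = T a b c" "T a c b = T a b c" "T c b a = T a b c" "T b c a = T a b c" "T c a b = T a b c"
  using image_sym assms by blast+

text \<open>The edge from \<open>c\<close> to \<open>e\<close> misses the triangle
  \<open>abd\<close>. With \<open>e\<close> inside \<open>abd\<close>, the vertex \<open>c\<close>
  would be inside too, although it lies on the larger triangle \<open>abc\<close>.\<close>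

lemma inside_subtriangle:
  assumes V: "a \<in> V" "b \<in> V" "c \<in> V" "d \<in> V" "e \<in> V" and dist: "distinct [a, b, c, d, e]"
    and d: "v d \<in> inside (T a b c)"
  shows "inside (T a b d) \<subseteq> inside (T a b c)" "v e \<notin> inside (T a b d)"
proof -
  have dd: "a \<noteq> b" "a \<noteq> c" "a \<noteq> d" "b \<noteq> c" "b \<noteq> d" "c \<noteq> d" "a \<noteq> e" "b \<noteq> e" "c \<noteq> e" "d \<noteq> e"
    using dist by auto
  show sub: "inside (T a b d) \<subseteq> inside (T a b c)"
    using theta_triangle[OF V(1-4) _ d] dist by auto
  show "v e \<notin> inside (T a b d)"
  proof
    assume e: "v e \<in> inside (T a b d)"
    have "P c e \<subseteq> inside (T a b d) \<or> P c e \<subseteq> outside (T a b d)"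
      using edge_same_side[of a b d c e] V dist by auto
    moreover have "v e \<in> P c e" "v c \<in> P c e" using vertex_in_image V dd by auto
    moreover have "inside (T a b d) \<inter> outside (T a b d) = {}" by (simp add: inside_Int_outside)
    ultimately have "v c \<in> inside (T a b d)" using e by blast
    moreover have "v c \<in> T a b c" using vertex_in_image[of b c] V dd by blast
    ultimately show False using sub inside_no_overlap by blast
  qed
qed

text \<open>The edges from \<open>d\<close> cut the inside of \<open>abc\<close> into three smaller
  triangles. The vertex \<open>e\<close> is in none of them, as each would separate it from the
  remaining corner, and it is on none of the cutting edges.\<close>

lemma not_both_inside:
  assumes V: "a \<in> V" "b \<in> V" "c \<in> V" "d \<in> V" "e \<in> V" and dist: "distinct [a, b, c, d, e]"
    and d: "v d \<in> inside (T a b c)" and e: "v e \<in> inside (T a b c)"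
  shows False
proof -
  have dd: "a \<noteq> b" "a \<noteq> c" "a \<noteq> d" "b \<noteq> c" "b \<noteq> d" "c \<noteq> d" "a \<noteq> e" "b \<noteq> e" "c \<noteq> e" "d \<noteq> e"
    using dist by auto
  let ?Q = "P a c \<union> P b c \<union> P a d \<union> P b d"
  let ?E = "P c d - {v c, v d}"
  note th = theta_triangle[OF V(1-4) _ d]
  note J = triangle_jordan[OF V(1-3) dd(1,4,2)]
  have "P d e \<inter> P a d = {v d}" "P d e \<inter> P b d = {v d}"
    using image_adjacent'[of d e a] image_adjacent'[of d e b] V dd by auto
  then have ePad: "v e \<notin> P a d \<union> P b d"
    using vertex_in_image[of d e] V dd arc_distinct_ends[OF arc_g[of d e]] start_g[of d e] finish_g[of d e]
    by (metis IntI Un_iff singletonD)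
  have Eends: "v c \<in> closure ?E" using closure_open_edge V dd by blast
  have Ein: "?E \<subseteq> inside (T a b c)"
    using open_edge_same_side(1)[OF V(1-4) _ d] dist by auto
  have "P c d \<inter> P a d = {v d}" "P c d \<inter> P b d = {v d}"
    using image_adjacent'[of d c a] image_adjacent'[of d c b] V dd by auto
  then have Ead: "?E \<inter> (P a d \<union> P b d) = {}" by blast
  \<comment> \<open>Otherwise the edge from \<open>c\<close> to \<open>d\<close> would run inside
    \<open>abd\<close>, and its end \<open>v c\<close> would lie in the closure of that
    region.\<close>
  have Q: "P c d \<inter> inside ?Q \<noteq> {}"
  proof
    assume "P c d \<inter> inside ?Q = {}"
    then have "?E \<subseteq> inside (T a b d)" using Ein th dist Ead by auto
    then have "v c \<in> closure (inside (T a b d))" using Eends closure_mono by blast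
    moreover have "closure (inside (T a b d)) \<subseteq> inside (T a b d) \<union> T a b d"
      using triangle_jordan(5)[OF V(1,2,4) dd(1,5,3)] closure_Un_frontier[of "inside (T a b d)"] by auto
    moreover have "v c \<notin> T a b d"
    proof -
      have "v c \<notin> P a b" "v c \<notin> P b d" "v c \<notin> P a d"
        using image_disjoint[of a b c e] image_disjoint[of b d c e] image_disjoint[of a d c e]
          vertex_in_image[of c e] V dd by blast+
      then show ?thesis by blast
    qed
    moreover have "v c \<notin> inside (T a b d)"
    proof
      assume "v c \<in> inside (T a b d)"
      then have "v c \<in> inside (T a b c)" using inside_subtriangle(1)[OF V dist d] by blast
      moreover have "v c \<in> T a b c" using vertex_in_image[of b c] V dd by blast
      ultimately show False using inside_no_overlap by blast
    qed
    ultimately show False by blast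
  qed
  have e_abd: "v e \<notin> inside (T a b d)" by (rule inside_subtriangle(2)[OF V dist d])
  have "v e \<in> inside ?Q"
    using e th dist e_abd ePad by auto
  then have "v e \<in> inside (T a c d) \<or> v e \<in> inside (T b c d) \<or> v e \<in> P c d"
    using theta_quadrilateral[OF V(1-4) _ Q] dist by auto
  moreover have "v e \<notin> inside (T a c d)"
    using inside_subtriangle(2)[of a c b d e] V dist d T_perm[OF V(1-3) dd(1,4,2)] by auto
  moreover have "v e \<notin> inside (T b c d)"
    using inside_subtriangle(2)[of b c a d e] V dist d T_perm[OF V(1-3) dd(1,4,2)] by auto
  moreover have "v e \<notin> P c d"
    using image_disjoint[of c d e a] vertex_in_image[of e a] V dd by blast
  ultimately show False by blast
qed

section \<open>Inversion and two vertices outside a triangle\<close>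

lemma inversion_drawing:
  assumes "\<And>i j. \<lbrakk>i \<in> V; j \<in> V; i \<noteq> j\<rbrakk> \<Longrightarrow> z \<notin> P i j"
  defines "f \<equiv> \<lambda>w. inverse (w - z)"
  shows "arc_drawing V (f \<circ> v) (\<lambda>i j. f \<circ> g i j)"
proof
  \<comment> \<open>Since \<open>inverse 0 = 0\<close>, the map is injective on the whole plane;
    continuity is only used away from \<open>z\<close>.\<close>
  have inj: "inj f" by (auto simp: inj_def f_def)
  fix i j assume ij: "i \<in> V" "j \<in> V" "i \<noteq> j"
  have "continuous_on (P i j) f"
    unfolding f_def using assms(1)[OF ij] by (intro continuous_intros) auto
  then have "path (f \<circ> g i j)" using arc_g[OF ij] by (intro path_continuous_image arc_imp_path)
  then show "arc (f \<circ> g i j)"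
    using arc_g[OF ij] inj by (auto simp: arc_def intro!: comp_inj_on intro: inj_on_subset)
  show "pathstart (f \<circ> g i j) = (f \<circ> v) i" using start_g[OF ij] by (simp add: pathstart_compose)
  show "pathfinish (f \<circ> g i j) = (f \<circ> v) j" using finish_g[OF ij] by (simp add: pathfinish_compose)
  show "path_image (f \<circ> g i j) = path_image (f \<circ> g j i)"
    using image_sym[OF ij] by (simp add: path_image_compose)
next
  have inj: "inj f" by (auto simp: inj_def f_def)
  fix i j k l assume "i \<in> V" "j \<in> V" "k \<in> V" "l \<in> V" "i \<noteq> j" "k \<noteq> l" "i \<noteq> k" "i \<noteq> l" "j \<noteq> k" "j \<noteq> l"
  then have "P i j \<inter> P k l = {}" by (rule image_disjoint)
  then show "path_image (f \<circ> g i j) \<inter> path_image (f \<circ> g k l) = {}"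
    by (simp add: path_image_compose flip: image_Int[OF inj])
next
  have inj: "inj f" by (auto simp: inj_def f_def)
  fix i j k assume "i \<in> V" "j \<in> V" "k \<in> V" "i \<noteq> j" "i \<noteq> k" "j \<noteq> k"
  then have "P i j \<inter> P i k = {v i}" by (rule image_adjacent)
  then show "path_image (f \<circ> g i j) \<inter> path_image (f \<circ> g i k) = {(f \<circ> v) i}"
    by (simp add: path_image_compose flip: image_Int[OF inj])
qed

text \<open>The component of \<open>f w\<close> off the image curve pulls back to a connected set
  outside the triangle, hence away from a ball about \<open>z\<close>. So the component is
  bounded.\<close>

lemma inside_inversion:
  assumes V: "a \<in> V" "b \<in> V" "c \<in> V" "a \<noteq> b" "b \<noteq> c" "a \<noteq> c"
    and z: "z \<in> inside (T a b c)" and w: "w \<in> outside (T a b c)"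
  defines "f \<equiv> \<lambda>w. inverse (w - z)"
  shows "f w \<in> inside (f ` T a b c)"
proof -
  let ?T = "T a b c"
  note J = triangle_jordan[OF V]
  obtain r where r: "r > 0" "ball z r \<subseteq> inside ?T" using J(1) z by (meson open_contains_ball)
  have inj: "inj f" by (auto simp: inj_def f_def)
  have zT: "z \<notin> ?T" "w \<notin> ?T" "w \<noteq> z" using z w J(3,4) by blast+
  have "compact (P i j)" if "i \<in> V" "j \<in> V" "i \<noteq> j" for i j
    using that arc_g by (auto intro: compact_arc_image)
  then have "compact ?T" using V by (intro compact_Un) auto
  moreover have "continuous_on ?T f"
    unfolding f_def using zT by (intro continuous_intros) auto
  ultimately have "compact (f ` ?T)" by (rule compact_continuous_image[rotated])
  then have op: "open (- (f ` ?T))" by (simp add: compact_imp_closed open_Compl)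
  define C where "C = connected_component_set (- (f ` ?T)) (f w)"
  \<comment> \<open>The inverse map is discontinuous at 0, the image of infinity. An open connected
    subset of the plane stays connected without this point.\<close>
  have "connected (C - {0})"
    unfolding C_def using op by (intro connected_open_delete open_connected_component connected_connected_component) auto
  moreover have "continuous_on (C - {0}) (\<lambda>u. inverse u + z)" by (intro continuous_intros) auto
  ultimately have conn: "connected ((\<lambda>u. inverse u + z) ` (C - {0}))"
    by (rule connected_continuous_image[rotated])
  have "(\<lambda>u. inverse u + z) ` (C - {0}) \<inter> ?T = {}"
  proof -
    have "inverse u + z \<notin> ?T" if "u \<in> C" for u
    proof
      assume "inverse u + z \<in> ?T"
      then have "f (inverse u + z) \<in> f ` ?T" by (rule imageI)
      then have "u \<in> f ` ?T" by (simp add: f_def)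
      then show False using that connected_component_subset[of "- (f ` ?T)" "f w"] by (auto simp: C_def)
    qed
    then show ?thesis by auto
  qed
  note side = connected_same_side[OF V conn this]
  have fw: "f w \<notin> f ` ?T" using zT inj by (simp add: inj_image_mem_iff)
  then have "f w \<in> C - {0}" using zT by (simp add: C_def f_def)
  then have "inverse (f w) + z \<in> (\<lambda>u. inverse u + z) ` (C - {0})" by (rule imageI)
  then have "w \<in> (\<lambda>u. inverse u + z) ` (C - {0})" by (simp add: f_def)
  then have out: "(\<lambda>u. inverse u + z) ` (C - {0}) \<subseteq> outside ?T" using side w J(3) by blast
  have "C \<subseteq> cball 0 (1 / r)"
  proof
    fix u assume u: "u \<in> C"
    show "u \<in> cball 0 (1 / r)"
    proof (cases "u = 0")
      case False
      then have "inverse u + z \<in> outside ?T" using out u by blast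
      then have "inverse u + z \<notin> ball z r" using r J(3) by blast
      then have "r \<le> 1 / norm u" by (simp add: dist_norm norm_inverse divide_inverse)
      then show ?thesis using r False by (simp add: field_simps)
    qed (use r in simp)
  qed
  then have "bounded C" using bounded_cball bounded_subset by blast
  then show ?thesis using fw by (simp add: inside_def C_def)
qed

text \<open>All edges at \<open>d\<close> or \<open>e\<close> stay outside the triangle apart from
  its corners, so a point \<open>z\<close> inside it lies on no arc. Inversion at \<open>z\<close>
  gives a drawing in which \<open>d\<close> and \<open>e\<close> are both inside.\<close>

lemma not_both_outside:
  assumes V: "V = {a, b, c, d, e}" and dist: "distinct [a, b, c, d, e]"
    and d: "v d \<in> outside (T a b c)" and e: "v e \<in> outside (T a b c)"
  shows False
proof -
  have mem: "a \<in> V" "b \<in> V" "c \<in> V" "d \<in> V" "e \<in> V" using V by auto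
  have dd: "a \<noteq> b" "a \<noteq> c" "a \<noteq> d" "b \<noteq> c" "b \<noteq> d" "c \<noteq> d" "a \<noteq> e" "b \<noteq> e" "c \<noteq> e" "d \<noteq> e"
    using dist by auto
  note J = triangle_jordan[OF mem(1-3) dd(1,4,2)]
  obtain z where z: "z \<in> inside (T a b c)" using J(6) by blast
  have no_in: "z \<notin> T a b c" "z \<notin> outside (T a b c)" using z J(3,4) by blast+
  have edge: "z \<notin> P x y" if x: "x \<in> {a, b, c}" and y: "y \<in> {d, e}" for x y
  proof -
    have vy: "v y \<in> outside (T a b c)" using y d e by auto
    \<comment> \<open>The corners are renamed so that \<open>x\<close> comes last, as in
      \<open>open_edge_same_side\<close>.\<close>
    obtain x1 x2 where xs: "x1 \<in> V" "x2 \<in> V" "x1 \<in> {a, b, c}" "x2 \<in> {a, b, c}"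
      "distinct [x1, x2, x]" and T: "T x1 x2 x = T a b c"
    proof -
      consider "x = a" | "x = b" | "x = c" using x by blast
      then show ?thesis
      proof cases
        case 1
        then show ?thesis using that[of b c] mem dd T_perm(4)[OF mem(1-3) dd(1,4,2)] by auto
      next
        case 2
        then show ?thesis using that[of a c] mem dd T_perm(2)[OF mem(1-3) dd(1,4,2)] by auto
      next
        case 3
        then show ?thesis using that[of a b] mem dd by auto
      qed
    qed
    have mx: "x \<in> V" "x1 \<in> V" "x2 \<in> V" "y \<in> V" using xs(1,2) x y mem by auto
    have "distinct [x1, x2, x, y]" using xs(3-5) y dd x by auto
    then have "P x y - {v x, v y} \<subseteq> outside (T a b c)"
      using open_edge_same_side(2)[OF mx(2,3,1,4)] vy T by simp
    moreover have "v x \<in> T a b c"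
      using x vertex_in_image[OF mem(1,2) dd(1)] vertex_in_image[OF mem(2,3) dd(4)] by auto
    ultimately show ?thesis using no_in vy by blast
  qed
  have "P d e \<subseteq> outside (T a b c)"
    using edge_same_side[OF mem dist] vertex_in_image[OF mem(4,5) dd(10)] d J(3) by blast
  then have de: "z \<notin> P d e" using no_in by blast
  have "z \<notin> P i j" if ij: "i \<in> V" "j \<in> V" "i \<noteq> j" for i j
  proof -
    consider "i \<in> {a, b, c}" "j \<in> {a, b, c}" | "i \<in> {a, b, c}" "j \<in> {d, e}"
      | "i \<in> {d, e}" "j \<in> {a, b, c}" | "i \<in> {d, e}" "j \<in> {d, e}" using ij V by auto
    then show ?thesis
    proof cases
      case 1
      then have "P i j \<subseteq> T a b c" using ij(3) image_sym mem dd by auto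
      then show ?thesis using no_in by blast
    next
      case 2
      then show ?thesis by (rule edge)
    next
      case 3
      then show ?thesis using edge[of j i] image_sym[OF ij] by simp
    next
      case 4
      then show ?thesis using de image_sym[OF ij] ij(3) by auto
    qed
  qed
  then interpret inv: arc_drawing V "(\<lambda>w. inverse (w - z)) \<circ> v" "\<lambda>i j. (\<lambda>w. inverse (w - z)) \<circ> g i j"
    by (rule inversion_drawing)
  have T: "inv.T a b c = (\<lambda>w. inverse (w - z)) ` T a b c"
    by (simp add: path_image_compose image_Un)
  show False
    using inv.not_both_inside[OF mem dist] inside_inversion[OF mem(1-3) dd(1,4,2) z] d e
    unfolding T by simp
qed

theorem no_five_vertices: "card V \<noteq> 5"
proof
  assume "card V = 5"
  then obtain a b c d e where V: "V = {a, b, c, d, e}" and dist: "distinct [a, b, c, d, e]"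
  proof -
    assume *: "\<And>a b c d e. V = {a, b, c, d, e} \<Longrightarrow> distinct [a, b, c, d, e] \<Longrightarrow> thesis"
    have "finite V" using \<open>card V = 5\<close> card.infinite by fastforce
    then obtain xs where xs: "set xs = V" "distinct xs" using finite_distinct_list by blast
    then have "length xs = 5" using \<open>card V = 5\<close> distinct_card by metis
    then obtain a b c d e where "xs = [a, b, c, d, e]" by (auto simp: length_Suc_conv numeral_eq_Suc)
    then show thesis using xs by (intro *[of a b c d e]) auto
  qed
  have mem: "a \<in> V" "b \<in> V" "c \<in> V" "d \<in> V" "e \<in> V" using V by auto
  have "v d \<in> P d e" "v e \<in> P d e" using vertex_in_image mem dist by auto
  then show False
    using edge_same_side[OF mem dist] not_both_inside[OF mem dist] not_both_outside[OF V dist] by blast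
qed

end

section \<open>No five pairwise touching convex sets in the plane\<close>

text \<open>The equation of \<open>H\<close> is arbitrary, and a product does not depend on its
  orientation. So several pairs that touch along the same \<open>H\<close> can be compared by
  signs.\<close>

lemma touch_along_opposite_sides:
  assumes "touch_along H A B" "H = {x. a \<bullet> x = b}" "x \<in> interior A" "y \<in> interior B"
  shows "(a \<bullet> x - b) * (a \<bullet> y - b) < 0"
proof (rule ccontr)
  assume "\<not> ?thesis"
  then have nonneg: "(a \<bullet> x - b) * (a \<bullet> y - b) \<ge> 0" by simp
  obtain a' b' where *: "H = {x. a' \<bullet> x = b'}" "A \<subseteq> {x. b' \<le> a' \<bullet> x}" "B \<subseteq> {x. a' \<bullet> x \<le> b'}"
    using assms(1) by (auto simp: touch_along_def)
  have xy: "b' \<le> a' \<bullet> x" "a' \<bullet> y \<le> b'" using * assms(3,4) interior_subset by auto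
  have "x \<notin> H" "y \<notin> H" using touch_along_interior[OF assms(1)] assms(3,4) by auto
  then have sides: "a \<bullet> x > b \<and> a \<bullet> y > b \<or> a \<bullet> x < b \<and> a \<bullet> y < b"
    using nonneg assms(2) by (auto simp: zero_le_mult_iff)
  obtain z where z: "z \<in> closed_segment y x" "a' \<bullet> z = b'"
    using connected_ivt_hyperplane[of "closed_segment y x" y x a' b'] xy by auto
  from sides have "a \<bullet> z \<noteq> b"
  proof
    assume "b < a \<bullet> x \<and> b < a \<bullet> y"
    then have "closed_segment y x \<subseteq> {z. b < a \<bullet> z}"
      by (intro closed_segment_subset) (auto simp: convex_halfspace_gt)
    then show ?thesis using z by auto
  next
    assume "a \<bullet> x < b \<and> a \<bullet> y < b"
    then have "closed_segment y x \<subseteq> {z. a \<bullet> z < b}"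
      by (intro closed_segment_subset) (auto simp: convex_halfspace_lt)
    then show ?thesis using z by auto
  qed
  then show False using z * assms(2) by auto
qed

text \<open>The segment from \<open>x\<close> to \<open>w\<close> can be prolonged beyond
  \<open>w\<close> within \<open>C\<close>, where a non-constant function would fall below its
  minimum.\<close>

lemma linear_min_rel_interior:
  fixes C :: "'a::euclidean_space set"
  assumes "convex C" "w \<in> rel_interior C" "\<And>x. x \<in> C \<Longrightarrow> a \<bullet> w \<le> a \<bullet> x" "x \<in> C"
  shows "a \<bullet> x = a \<bullet> w"
proof -
  have "C \<noteq> {}" using assms(4) by auto
  then obtain e where e: "e > 1" "(1 - e) *\<^sub>R x + e *\<^sub>R w \<in> C"
    using convex_rel_interior_iff[OF assms(1)] assms(2,4) by blast
  have "a \<bullet> w \<le> (1 - e) * (a \<bullet> x) + e * (a \<bullet> w)"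
    using assms(3)[OF e(2)] by (simp add: inner_simps)
  then have "(e - 1) * (a \<bullet> x) \<le> (e - 1) * (a \<bullet> w)" by (simp add: algebra_simps)
  then have "a \<bullet> x \<le> a \<bullet> w" using e(1) by simp
  then show ?thesis using assms(3,4) by (simp add: antisym)
qed

text \<open>\<open>w\<close> is a relative interior point of the hull of the common boundary. If it
  were in \<open>closure C\<close>, the hyperplanes between \<open>C\<close> and each of
  \<open>A\<close>, \<open>B\<close> would support this hull at \<open>w\<close> and so equal
  \<open>H\<close>; but three sets cannot lie pairwise on opposite sides of
  \<open>H\<close>.\<close>

lemma touch_point:
  fixes A B :: "'a::euclidean_space set"
  assumes cA: "convex A" and cB: "convex B" and AB: "touch_along H A B"
  obtains w where "w \<in> closure A" "w \<in> closure B"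
    "\<And>C H1 H2. touch_along H1 A C \<Longrightarrow> touch_along H2 B C \<Longrightarrow> w \<notin> closure C"
proof -
  obtain a b W where *: "a \<noteq> 0" "H = {x. a \<bullet> x = b}" "W \<subseteq> closure A \<inter> closure B" "affine hull W = H"
    using AB by (auto simp: touch_along_def)
  define D where "D = convex hull W"
  have "D \<subseteq> closure A" "D \<subseteq> closure B"
    unfolding D_def using *(3) cA cB by (intro hull_minimal; auto)+
  then have D: "convex D" "D \<subseteq> closure A" "D \<subseteq> closure B" "affine hull D = H"
    using *(4) by (simp_all add: D_def)
  have "(b / (a \<bullet> a)) *\<^sub>R a \<in> H" using *(1,2) by simp
  then have "D \<noteq> {}" using D(4) by auto
  then obtain w where w: "w \<in> rel_interior D" using rel_interior_eq_empty[OF D(1)] by auto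
  then have wD: "w \<in> D" using rel_interior_subset by auto
  have same: "H1 = H" if t: "touch_along H1 E C" and DE: "D \<subseteq> closure E" and wC: "w \<in> closure C" for E C H1
  proof -
    obtain a' b' where **: "a' \<noteq> 0" "H1 = {x. a' \<bullet> x = b'}" "E \<subseteq> {x. b' \<le> a' \<bullet> x}" "C \<subseteq> {x. a' \<bullet> x \<le> b'}"
      using t by (auto simp: touch_along_def)
    have cl: "closure E \<subseteq> {x. b' \<le> a' \<bullet> x}" "closure C \<subseteq> {x. a' \<bullet> x \<le> b'}"
      using ** by (simp_all add: closure_minimal closed_halfspace_ge closed_halfspace_le)
    then have wb: "a' \<bullet> w = b'" using wD DE wC by fastforce
    have "a' \<bullet> x = b'" if "x \<in> D" for x
      using linear_min_rel_interior[OF D(1) w, of a' x] that cl(1) DE wb by auto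
    then have "D \<subseteq> H1" using **(2) by auto
    then have "H \<subseteq> H1" using D(4) **(2) by (metis affine_hyperplane hull_minimal)
    moreover have "H \<noteq> {}" using \<open>D \<noteq> {}\<close> D(4) by auto
    ultimately show "H1 = H"
      using *(1,2) ** by (intro affine_dim_equal[symmetric]) (auto simp: affine_hyperplane)
  qed
  have "w \<notin> closure C" if AC: "touch_along H1 A C" and BC: "touch_along H2 B C" for C H1 H2
  proof
    assume wC: "w \<in> closure C"
    then have "touch_along H A C" "touch_along H B C"
      using same[OF AC D(2)] same[OF BC D(3)] AC BC by auto
    moreover obtain x y z where "x \<in> interior A" "y \<in> interior B" "z \<in> interior C"
      using AB AC by (fastforce simp: touch_along_def)
    ultimately have "(a \<bullet> x - b) * (a \<bullet> y - b) < 0" "(a \<bullet> x - b) * (a \<bullet> z - b) < 0"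
      "(a \<bullet> y - b) * (a \<bullet> z - b) < 0"
      using touch_along_opposite_sides *(2) AB by blast+
    then show False by (auto simp: mult_less_0_iff)
  qed
  then show ?thesis using that[of w] wD D(2,3) by blast
qed

lemma Int_closed_segments_eq:
  fixes v :: "'a::euclidean_space"
  assumes "p \<noteq> q" "v \<notin> affine hull {p, q}"
  shows "closed_segment v p \<inter> closed_segment v q = {v}"
proof -
  have "x = v" if "x \<in> closed_segment v p" "x \<in> closed_segment v q" for x
  proof (rule ccontr)
    assume "x \<noteq> v"
    obtain s where s: "x = (1 - s) *\<^sub>R v + s *\<^sub>R p"
      using \<open>x \<in> closed_segment v p\<close> unfolding in_segment by blast
    obtain t where t: "x = (1 - t) *\<^sub>R v + t *\<^sub>R q"
      using \<open>x \<in> closed_segment v q\<close> unfolding in_segment by blast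
    have eq: "(s - t) *\<^sub>R v = s *\<^sub>R p - t *\<^sub>R q" using s t by (simp add: algebra_simps)
    show False
    proof (cases "s = t")
      case True
      then have "s \<noteq> 0" using s \<open>x \<noteq> v\<close> by auto
      then show False using eq True assms(1) by simp
    next
      case False
      have "v = (1 / (s - t)) *\<^sub>R ((s - t) *\<^sub>R v)" using False by simp
      also have "\<dots> = (s / (s - t)) *\<^sub>R p + (- t / (s - t)) *\<^sub>R q"
        unfolding eq by (simp add: algebra_simps)
      finally have "v = (s / (s - t)) *\<^sub>R p + (- t / (s - t)) *\<^sub>R q" .
      moreover have "s / (s - t) + - t / (s - t) = 1" using False by (simp flip: diff_divide_distrib)
      ultimately have "v \<in> affine hull {p, q}" unfolding affine_hull_2 by blast
      then show False using assms(2) by simp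
    qed
  qed
  then show ?thesis by auto
qed

lemma no_five_touching:
  fixes K :: "'v \<Rightarrow> 'a::euclidean_space set"
  assumes dim: "DIM('a) = 2" and card: "card V = 5"
    and cv: "\<And>i. i \<in> V \<Longrightarrow> convex (K i)"
    and touch: "\<And>i j. i \<in> V \<Longrightarrow> j \<in> V \<Longrightarrow> i \<noteq> j \<Longrightarrow> \<exists>H. touch_along H (K i) (K j)"
  shows False
proof -
  have finV: "finite V" using card card.infinite by fastforce
  \<comment> \<open>The point is chosen per unordered pair, so that the arcs from \<open>i\<close>
    to \<open>j\<close> and from \<open>j\<close> to \<open>i\<close> pass through the same
    point.\<close>
  have "\<exists>w. \<forall>i j. e = {i, j} \<and> i \<in> V \<and> j \<in> V \<and> i \<noteq> j \<longrightarrow>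
      w \<in> closure (K i) \<and> w \<in> closure (K j) \<and> (\<forall>l\<in>V - {i, j}. w \<notin> closure (K l))" for e
  proof (cases "\<exists>i j. e = {i, j} \<and> i \<in> V \<and> j \<in> V \<and> i \<noteq> j")
    case True
    then obtain i j where ij: "e = {i, j}" "i \<in> V" "j \<in> V" "i \<noteq> j" by blast
    then obtain H where "touch_along H (K i) (K j)" using touch by blast
    then obtain w where w: "w \<in> closure (K i)" "w \<in> closure (K j)"
      "\<And>C H1 H2. touch_along H1 (K i) C \<Longrightarrow> touch_along H2 (K j) C \<Longrightarrow> w \<notin> closure C"
      using touch_point[OF cv cv] ij by metis
    have "w \<notin> closure (K l)" if l: "l \<in> V - {i, j}" for l
    proof -
      obtain H1 H2 where "touch_along H1 (K i) (K l)" "touch_along H2 (K j) (K l)"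
        using touch[of i l] touch[of j l] ij l by blast
      then show ?thesis by (rule w(3))
    qed
    then show ?thesis using w(1,2) ij(1) by (intro exI[of _ w]) (auto simp: doubleton_eq_iff)
  qed auto
  then obtain w where w: "\<And>e i j. e = {i, j} \<Longrightarrow> i \<in> V \<Longrightarrow> j \<in> V \<Longrightarrow> i \<noteq> j \<Longrightarrow>
      w e \<in> closure (K i) \<and> w e \<in> closure (K j) \<and> (\<forall>l\<in>V - {i, j}. w e \<notin> closure (K l))"
    by metis
  have w_cl: "w {i, j} \<in> closure (K i)" "w {i, j} \<in> closure (K j)" if "i \<in> V" "j \<in> V" "i \<noteq> j" for i j
    using w[OF refl that] by blast+
  have w_ncl: "w {i, j} \<notin> closure (K l)" if "i \<in> V" "j \<in> V" "i \<noteq> j" "l \<in> V" "l \<noteq> i" "l \<noteq> j" for i j l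
    using w[OF refl that(1-3)] that by blast
  have w_ne: "w {i, j} \<noteq> w {i, k}" if "i \<in> V" "j \<in> V" "k \<in> V" "i \<noteq> j" "i \<noteq> k" "j \<noteq> k" for i j k
    using w_cl(2)[of i k] w_ncl[of i j k] that by metis
  define T where "T i = interior (K i)" for i
  have T_ne: "T i \<noteq> {}" if i: "i \<in> V" for i
  proof -
    have "V \<noteq> {i}" using card by auto
    then obtain j where "j \<in> V" "j \<noteq> i" using i by blast
    then show ?thesis using touch[of i j] i by (auto simp: touch_along_def T_def)
  qed
  have T_disj: "T i \<inter> T j = {}" if "i \<in> V" "j \<in> V" "i \<noteq> j" for i j
    using touch[OF that] touch_along_interior(1) by (auto simp: T_def)
  have w_nT: "w {i, j} \<notin> T l" if "i \<in> V" "j \<in> V" "i \<noteq> j" "l \<in> V" for i j l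
  proof (cases "l = i \<or> l = j")
    case False
    then have "w {i, j} \<notin> closure (K l)" using w_ncl that by blast
    then show ?thesis
      using interior_subset[of "K l"] closure_subset[of "K l"] unfolding T_def by blast
  next
    case True
    then have "\<exists>m. m \<in> V \<and> m \<noteq> l \<and> w {i, j} \<in> closure (K m)" using w_cl[OF that(1-3)] that by metis
    then obtain m where m: "m \<in> V" "m \<noteq> l" "w {i, j} \<in> closure (K m)" by blast
    have "T l \<inter> T m = {}" using T_disj m that by auto
    then have "T l \<inter> closure (T m) = {}" by (simp add: open_Int_closure_eq_empty T_def)
    moreover have "closure (T m) = closure (K m)"
      using T_ne[OF m(1)] cv[OF m(1)] by (simp add: T_def convex_closure_interior)
    ultimately show ?thesis using m(3) by blast
  qed
  have seg: "closed_segment x (w {i, j}) \<subseteq> insert (w {i, j}) (T i)"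
    if "i \<in> V" "j \<in> V" "i \<noteq> j" "x \<in> T i" for i j x
    using in_interior_closure_convex_segment[OF cv[OF that(1)], of x "w {i, j}"] that w_cl(1)[OF that(1-3)]
    by (auto simp: T_def closed_segment_eq_open)
  \<comment> \<open>A vertex off all lines through two of its boundary points: then the segments
    from it meet only at the vertex. An open set in the plane is not covered by finitely many
    lines.\<close>
  have "\<exists>x. x \<in> T i \<and> (\<forall>j\<in>V. \<forall>k\<in>V. x \<notin> affine hull {w {i, j}, w {i, k}})" if i: "i \<in> V" for i
  proof (rule ccontr)
    let ?F = "(\<lambda>(j, k). affine hull {w {i, j}, w {i, k}}) ` (V \<times> V)"
    assume "\<not> ?thesis"
    then have "T i \<subseteq> \<Union>?F" by fastforce
    moreover have "convex (T i)" using cv[OF i] by (simp add: T_def convex_interior)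
    ultimately have "\<exists>A\<in>?F. T i \<subseteq> A"
      using finV T_ne[OF i] by (intro convex_subset_Union_affine) auto
    then obtain j k where "T i \<subseteq> affine hull {w {i, j}, w {i, k}}" by auto
    then have "aff_dim (T i) \<le> aff_dim {w {i, j}, w {i, k}}" by (metis aff_dim_affine_hull aff_dim_subset)
    moreover have "aff_dim {w {i, j}, w {i, k}} \<le> 1" by (simp add: aff_dim_2)
    moreover have "aff_dim (T i) = 2" using T_ne[OF i] dim by (simp add: T_def aff_dim_open)
    ultimately show False by simp
  qed
  then obtain v where vT: "\<And>i. i \<in> V \<Longrightarrow> v i \<in> T i"
    and v: "\<And>i j k. i \<in> V \<Longrightarrow> j \<in> V \<Longrightarrow> k \<in> V \<Longrightarrow> v i \<notin> affine hull {w {i, j}, w {i, k}}"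
    by metis
  define \<gamma> where "\<gamma> i j = linepath (v i) (w {i, j}) +++ linepath (w {i, j}) (v j)" for i j
  have image: "path_image (\<gamma> i j) = closed_segment (v i) (w {i, j}) \<union> closed_segment (v j) (w {i, j})" for i j
    by (simp add: \<gamma>_def path_image_join closed_segment_commute)
  have sub: "closed_segment (v i) (w {i, j}) \<subseteq> insert (w {i, j}) (T i)"
    "closed_segment (v j) (w {i, j}) \<subseteq> insert (w {i, j}) (T j)" if "i \<in> V" "j \<in> V" "i \<noteq> j" for i j
    using seg[of i j "v i"] seg[of j i "v j"] vT that by (auto simp: insert_commute)
  have arc: "arc (\<gamma> i j)" if ij: "i \<in> V" "j \<in> V" "i \<noteq> j" for i j
    unfolding \<gamma>_def
  proof (rule arc_join)
    have "v i \<noteq> w {i, j}" "v j \<noteq> w {i, j}" using vT w_nT ij by metis+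
    then show "arc (linepath (v i) (w {i, j}))" "arc (linepath (w {i, j}) (v j))" by auto
    show "path_image (linepath (v i) (w {i, j})) \<inter> path_image (linepath (w {i, j}) (v j))
        \<subseteq> {pathstart (linepath (w {i, j}) (v j))}"
      using sub[OF ij] T_disj[OF ij] by (auto simp: closed_segment_commute)
  qed simp
  have disj: "path_image (\<gamma> i j) \<inter> path_image (\<gamma> k l) = {}"
    if "i \<in> V" "j \<in> V" "k \<in> V" "l \<in> V" "i \<noteq> j" "k \<noteq> l" "i \<noteq> k" "i \<noteq> l" "j \<noteq> k" "j \<noteq> l" for i j k l
  proof -
    have "path_image (\<gamma> i j) \<subseteq> insert (w {i, j}) (T i \<union> T j)" "path_image (\<gamma> k l) \<subseteq> insert (w {k, l}) (T k \<union> T l)"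
      unfolding image using sub[of i j] sub[of k l] that by blast+
    moreover have "w {i, j} \<noteq> w {k, l}" using w_cl(1)[of k l] w_ncl[of i j k] that by metis
    moreover have "w {i, j} \<notin> T k" "w {i, j} \<notin> T l" "w {k, l} \<notin> T i" "w {k, l} \<notin> T j"
      using w_nT that by blast+
    moreover have "T i \<inter> T k = {}" "T i \<inter> T l = {}" "T j \<inter> T k = {}" "T j \<inter> T l = {}"
      using T_disj that by blast+
    ultimately show ?thesis by blast
  qed
  have adj: "path_image (\<gamma> i j) \<inter> path_image (\<gamma> i k) = {v i}"
    if ijk: "i \<in> V" "j \<in> V" "k \<in> V" "i \<noteq> j" "i \<noteq> k" "j \<noteq> k" for i j k
  proof -
    let ?p = "w {i, j}" and ?q = "w {i, k}"
    have ne: "?p \<noteq> ?q" using w_ne ijk by auto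
    have nT: "?p \<notin> T i" "?p \<notin> T k" "?q \<notin> T i" "?q \<notin> T j" "?q \<notin> T k"
      using w_nT ijk by blast+
    have disj: "T i \<inter> T k = {}" "T i \<inter> T j = {}" "T j \<inter> T k = {}"
      using T_disj ijk by blast+
    note sub1 = sub[OF ijk(1,2,4)] and sub2 = sub[OF ijk(1,3,5)]
    have "closed_segment (v i) ?p \<inter> closed_segment (v i) ?q = {v i}"
      using ne v ijk by (intro Int_closed_segments_eq) auto
    moreover have "insert ?p (T i) \<inter> insert ?q (T k) = {}" "insert ?p (T j) \<inter> insert ?q (T i) = {}"
      "insert ?p (T j) \<inter> insert ?q (T k) = {}"
      using ne nT disj by auto
    then have "closed_segment (v i) ?p \<inter> closed_segment (v k) ?q = {}"
      "closed_segment (v j) ?p \<inter> closed_segment (v i) ?q = {}"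
      "closed_segment (v j) ?p \<inter> closed_segment (v k) ?q = {}"
      using Int_mono[OF sub1(1) sub2(2)] Int_mono[OF sub1(2) sub2(1)] Int_mono[OF sub1(2) sub2(2)]
      by auto
    ultimately show ?thesis unfolding image by (simp add: Int_Un_distrib Int_Un_distrib2)
  qed
  obtain f :: "'a \<Rightarrow> complex" and h where f: "linear f" "linear h" "\<And>x. h (f x) = x"
    using isomorphisms_UNIV_UNIV[where 'M = 'a and 'N = complex] dim by (metis DIM_complex)
  have inj: "inj f" using f(3) by (metis injI)
  have cont: "continuous_on A f" for A using f(1) by (simp add: linear_continuous_on linear_conv_bounded_linear)
  interpret arc_drawing V "f \<circ> v" "\<lambda>i j. f \<circ> \<gamma> i j"
  proof
    fix i j assume ij: "i \<in> V" "j \<in> V" "i \<noteq> j"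
    show "arc (f \<circ> \<gamma> i j)"
      using arc[OF ij] inj cont
      by (auto simp: arc_def intro!: comp_inj_on path_continuous_image intro: inj_on_subset)
    show "pathstart (f \<circ> \<gamma> i j) = (f \<circ> v) i" "pathfinish (f \<circ> \<gamma> i j) = (f \<circ> v) j"
      by (simp_all add: \<gamma>_def pathstart_compose pathfinish_compose)
    show "path_image (f \<circ> \<gamma> i j) = path_image (f \<circ> \<gamma> j i)"
      by (simp add: path_image_compose image insert_commute Un_commute)
  qed (simp_all add: path_image_compose disj adj flip: image_Int[OF inj])
  show False using no_five_vertices card by simp
qed

section \<open>Turan numbers\<close>

definition multipartite :: "('v \<Rightarrow> 'c) \<Rightarrow> 'v set \<Rightarrow> 'v set set" where
  "multipartite c V = {{u, v} |u v. u \<in> V \<and> v \<in> V \<and> c u \<noteq> c v}"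

lemma multipartite_subset: "multipartite c V \<subseteq> nsets V 2"
  by (fastforce simp: multipartite_def nsets_2_eq)

lemma finite_multipartite: "finite V \<Longrightarrow> finite (multipartite c V)"
  using multipartite_subset finite_imp_finite_nsets finite_subset by blast

text \<open>
  Erdos' argument: let \<open>x\<close> have maximal degree and \<open>N\<close> its neighbourhood. The graph on \<open>N\<close> has
  smaller clique number, and at most \<open>card (V - N) * card N\<close> edges meet \<open>V - N\<close>; make \<open>V - N\<close> one
  more colour class.
\<close>

lemma turan_bound:
  fixes E :: "'v set set"
  assumes "finite V" "E \<subseteq> nsets V 2" "\<not> (\<exists>W\<in>nsets V (r + 1). clique W E)"
  shows "\<exists>c :: 'v \<Rightarrow> nat. c ` V \<subseteq> {..<r} \<and> card E \<le> card (multipartite c V)"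
  using assms
proof (induction r arbitrary: V E)
  case 0
  have "V = {}"
  proof (rule ccontr)
    assume "V \<noteq> {}"
    then obtain x where "x \<in> V" by blast
    then have "{x} \<in> nsets V (0 + 1)" "clique {x} E" by (auto simp: nsets_def clique_def)
    then show False using 0(3) by blast
  qed
  moreover from this have "nsets V 2 = {}" by (auto simp: nsets_def)
  ultimately show ?case using 0(2) by auto
next
  case (Suc r)
  define nb where "nb x = {y \<in> V. {x, y} \<in> E \<and> x \<noteq> y}" for x
  show ?case
  proof (cases "V = {}")
    case True
    then have "nsets V 2 = {}" by (auto simp: nsets_def)
    then show ?thesis using Suc.prems(2) True by auto
  next
    case False
    have fin: "finite ((card \<circ> nb) ` V)" "(card \<circ> nb) ` V \<noteq> {}" using Suc.prems(1) False by auto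
    obtain x where x: "x \<in> V" "card (nb x) = Max ((card \<circ> nb) ` V)" using Max_in[OF fin] by auto
    have xmax: "card (nb y) \<le> card (nb x)" if "y \<in> V" for y
      unfolding x(2) using that fin(1) by (intro Max_ge) auto
    define N where "N = nb x"
    define E' where "E' = E \<inter> nsets N 2"
    have NV: "N \<subseteq> V" "x \<notin> N" by (auto simp: N_def nb_def)
    have finN: "finite N" using NV Suc.prems(1) finite_subset by blast
    have finE: "finite E" using Suc.prems finite_imp_finite_nsets finite_subset by blast
    have "\<not> (\<exists>W\<in>nsets N (r + 1). clique W E')"
    proof
      assume "\<exists>W\<in>nsets N (r + 1). clique W E'"
      then obtain W where W: "W \<subseteq> N" "finite W" "card W = r + 1" "clique W E'"
        by (auto simp: nsets_def)
      have "x \<notin> W" using W NV by auto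
      then have "insert x W \<in> nsets V (Suc r + 1)" using W NV x by (auto simp: nsets_def)
      moreover have "clique (insert x W) E"
        using W by (auto simp: clique_def E'_def N_def nb_def insert_commute subset_iff)
      ultimately show False using Suc.prems(3) by blast
    qed
    then obtain c where c: "c ` N \<subseteq> {..<r}" "card E' \<le> card (multipartite c N)"
      using Suc.IH[of N E'] finN by (auto simp: E'_def)
    define c' where "c' y = (if y \<in> N then c y else r)" for y
    have c'V: "c' ` V \<subseteq> {..<Suc r}" using c(1) by (auto simp: c'_def less_Suc_eq)
    \<comment> \<open>Each remaining edge is charged to an endpoint outside \<open>N\<close>, whose
      degree is at most \<open>card N\<close>.\<close>
    have "E - E' \<subseteq> (\<Union>y\<in>V - N. (\<lambda>z. {y, z}) ` nb y)"
    proof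
      fix e assume e: "e \<in> E - E'"
      then obtain y z where yz: "e = {y, z}" "y \<in> V" "z \<in> V" "y \<noteq> z"
        using Suc.prems(2) nsets2_E by blast
      then have "y \<notin> N \<or> z \<notin> N" using e by (auto simp: E'_def nsets_2_eq)
      then show "e \<in> (\<Union>y\<in>V - N. (\<lambda>z. {y, z}) ` nb y)"
      proof
        assume "y \<notin> N"
        then show ?thesis using e yz by (intro UN_I[of y]) (auto simp: nb_def)
      next
        assume "z \<notin> N"
        then show ?thesis using e yz by (intro UN_I[of z]) (auto simp: nb_def insert_commute)
      qed
    qed
    moreover have fin_nb: "finite (nb y)" for y using Suc.prems(1) by (simp add: nb_def)
    ultimately have "card (E - E') \<le> card (\<Union>y\<in>V - N. (\<lambda>z. {y, z}) ` nb y)"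
      using Suc.prems(1) by (intro card_mono) auto
    also have "\<dots> \<le> (\<Sum>y\<in>V - N. card ((\<lambda>z. {y, z}) ` nb y))"
      using Suc.prems(1) by (intro card_UN_le) auto
    also have "\<dots> \<le> (\<Sum>y\<in>V - N. card N)"
      unfolding N_def using xmax by (intro sum_mono order_trans[OF card_image_le[OF fin_nb]]) auto
    also have "\<dots> = card ((\<lambda>(y, z). {y, z}) ` ((V - N) \<times> N))"
    proof -
      have "inj_on (\<lambda>(y, z). {y, z}) ((V - N) \<times> N)"
        by (auto simp: inj_on_def doubleton_eq_iff)
      then show ?thesis by (simp add: card_image card_cartesian_product)
    qed
    finally have 1: "card (E - E') \<le> card ((\<lambda>(y, z). {y, z}) ` ((V - N) \<times> N))" .
    have "card E \<le> card E' + card (E - E')"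
      using finE by (simp add: E'_def card_Diff_subset_Int Int_commute)
    also have "\<dots> \<le> card (multipartite c N) + card ((\<lambda>(y, z). {y, z}) ` ((V - N) \<times> N))"
      using 1 c(2) by simp
    also have "\<dots> = card (multipartite c N \<union> (\<lambda>(y, z). {y, z}) ` ((V - N) \<times> N))"
      using finN Suc.prems(1)
      by (intro card_Un_disjoint[symmetric] finite_multipartite)
        (auto simp: multipartite_def doubleton_eq_iff)
    also have "\<dots> \<le> card (multipartite c' V)"
    proof (rule card_mono)
      show "finite (multipartite c' V)" using Suc.prems(1) by (rule finite_multipartite)
      have "multipartite c N \<subseteq> multipartite c' V"
      proof
        fix e assume "e \<in> multipartite c N"
        then obtain y z where "e = {y, z}" "y \<in> N" "z \<in> N" "c y \<noteq> c z"
          by (auto simp: multipartite_def)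
        then show "e \<in> multipartite c' V"
          unfolding multipartite_def using NV(1) by (intro CollectI exI[of _ y] exI[of _ z]) (auto simp: c'_def)
      qed
      moreover have "(\<lambda>(y, z). {y, z}) ` ((V - N) \<times> N) \<subseteq> multipartite c' V"
      proof
        fix e assume "e \<in> (\<lambda>(y, z). {y, z}) ` ((V - N) \<times> N)"
        then obtain y z where yz: "e = {y, z}" "y \<in> V" "y \<notin> N" "z \<in> N" by auto
        have "c z < r" using c(1) yz(4) by auto
        then have "c' y \<noteq> c' z" using yz by (simp add: c'_def)
        then show "e \<in> multipartite c' V" using yz NV by (auto simp: multipartite_def)
      qed
      ultimately show "multipartite c N \<union> (\<lambda>(y, z). {y, z}) ` ((V - N) \<times> N) \<subseteq> multipartite c' V"
        by (rule Un_least)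
    qed
    finally show ?thesis using c'V by blast
  qed
qed

section \<open>Extremal colourings and the count for four classes\<close>

lemma multipartite_clique_free:
  assumes "c ` V \<subseteq> {..<r}"
  shows "\<not> (\<exists>W\<in>nsets V (r + 1). clique W (multipartite c V))"
proof
  assume "\<exists>W\<in>nsets V (r + 1). clique W (multipartite c V)"
  then obtain W where W: "W \<subseteq> V" "finite W" "card W = r + 1" "clique W (multipartite c V)"
    by (auto simp: nsets_def)
  have "inj_on c W"
    using W(4) by (fastforce simp: inj_on_def clique_def multipartite_def doubleton_eq_iff)
  moreover have "c ` W \<subseteq> {..<r}" using W(1) assms by auto
  ultimately have "card W \<le> card {..<r}" by (intro card_inj_on_le) auto
  then show False using W(3) by simp
qed

lemma turan_graphs_finite:
  fixes n :: nat
  shows "finite {card E | E. E \<subseteq> nsets {..<n} 2 \<and> \<not> (\<exists>V\<in>nsets {..<n} (r + 1). clique V E)}"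
proof -
  have "finite (Pow (nsets {..<n} 2))" by (simp add: finite_imp_finite_nsets)
  then have "finite (card ` Pow (nsets {..<n} 2))" by simp
  then show ?thesis by (rule finite_subset[rotated]) auto
qed

lemma le_turan_number:
  fixes n :: nat
  assumes "E \<subseteq> nsets {..<n} 2" "\<not> (\<exists>V\<in>nsets {..<n} (r + 1). clique V E)"
  shows "card E \<le> turan_number n r"
  unfolding turan_number_def using assms by (intro Max_ge turan_graphs_finite) auto

lemma turan_number_multipartite:
  assumes "r > 0"
  obtains c :: "nat \<Rightarrow> nat" where "c ` {..<n} \<subseteq> {..<r}" "turan_number n r = card (multipartite c {..<n})"
proof -
  let ?M = "{card E | E. E \<subseteq> nsets {..<n} 2 \<and> \<not> (\<exists>V\<in>nsets {..<n} (r + 1). clique V E)}"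
  \<comment> \<open>For \<open>r > 0\<close> the empty graph is admissible, so the maximum is taken
    over a nonempty set.\<close>
  have "clique V ({} :: nat set set) \<Longrightarrow> V \<in> nsets {..<n} (r + 1) \<Longrightarrow> False" for V
  proof -
    assume V: "clique V ({} :: nat set set)" "V \<in> nsets {..<n} (r + 1)"
    then have "V \<subseteq> {x}" if "x \<in> V" for x using that by (auto simp: clique_def)
    then have "card V \<le> 1" by (metis card.empty card_mono ex_in_conv finite.emptyI finite_insert is_singletonI is_singleton_altdef zero_le_one)
    then show False using V(2) assms by (simp add: nsets_def)
  qed
  then have "?M \<noteq> {}" by blast
  then have "turan_number n r \<in> ?M" unfolding turan_number_def by (intro Max_in turan_graphs_finite)
  then obtain E where E: "turan_number n r = card E" "E \<subseteq> nsets {..<n} 2"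
    "\<not> (\<exists>V\<in>nsets {..<n} (r + 1). clique V E)" by blast
  then obtain c :: "nat \<Rightarrow> nat" where c: "c ` {..<n} \<subseteq> {..<r}" "card E \<le> card (multipartite c {..<n})"
    using turan_bound[of "{..<n}" E r] by blast
  have "card (multipartite c {..<n}) \<le> turan_number n r"
    by (intro le_turan_number multipartite_subset multipartite_clique_free c(1))
  then show ?thesis using c E(1) by (intro that[of c]) auto
qed

text \<open>Ordered pairs of vertices are counted by whether their colours agree; an edge accounts
  for two pairs.\<close>

lemma card_multipartite:
  fixes c :: "'v \<Rightarrow> nat"
  assumes V: "finite V" and c: "c ` V \<subseteq> {..<r}"
  shows "2 * card (multipartite c V) + (\<Sum>i<r. (card {u \<in> V. c u = i})\<^sup>2) = (card V)\<^sup>2"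
proof -
  let ?D = "{(u, v). u \<in> V \<and> v \<in> V \<and> c u \<noteq> c v}"
  let ?B = "(\<Union>i<r. {u \<in> V. c u = i} \<times> {u \<in> V. c u = i})"
  have finD: "finite ?D" by (rule finite_subset[of _ "V \<times> V"]) (use V in auto)
  have "card ?D = (\<Sum>e\<in>multipartite c V. card {p \<in> ?D. (\<lambda>(u, v). {u, v}) p = e})"
  proof -
    have "?D = (\<Union>e\<in>multipartite c V. {p \<in> ?D. (\<lambda>(u, v). {u, v}) p = e})"
      by (auto simp: multipartite_def)
    then have "card ?D = card (\<Union>e\<in>multipartite c V. {p \<in> ?D. (\<lambda>(u, v). {u, v}) p = e})" by (rule arg_cong)
    also have "\<dots> = (\<Sum>e\<in>multipartite c V. card {p \<in> ?D. (\<lambda>(u, v). {u, v}) p = e})"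
      by (rule card_UN_disjoint) (use V finD in \<open>auto simp: finite_multipartite\<close>)
    finally show ?thesis .
  qed
  also have "\<dots> = (\<Sum>e\<in>multipartite c V. 2)"
  proof (rule sum.cong[OF refl])
    fix e assume "e \<in> multipartite c V"
    then obtain u v where uv: "e = {u, v}" "u \<in> V" "v \<in> V" "c u \<noteq> c v" by (auto simp: multipartite_def)
    then have eq: "{p \<in> ?D. (\<lambda>(u, v). {u, v}) p = e} = {(u, v), (v, u)}"
      by (auto simp: doubleton_eq_iff)
    have "(u, v) \<noteq> (v, u)" using uv(4) by blast
    then show "card {p \<in> ?D. (\<lambda>(u, v). {u, v}) p = e} = 2" unfolding eq by simp
  qed
  finally have D: "card ?D = 2 * card (multipartite c V)" by simp
  have B: "card ?B = (\<Sum>i<r. (card {u \<in> V. c u = i})\<^sup>2)"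
    using V by (subst card_UN_disjoint) (auto simp: card_cartesian_product power2_eq_square)
  have "V \<times> V = ?D \<union> ?B"
  proof (intro equalityI subsetI)
    fix p assume "p \<in> V \<times> V"
    then obtain u v where p: "p = (u, v)" "u \<in> V" "v \<in> V" by blast
    then have "c u < r" using c by auto
    then show "p \<in> ?D \<union> ?B" using p by (cases "c u = c v") auto
  qed auto
  then have "(card V)\<^sup>2 = card (?D \<union> ?B)"
    using card_cartesian_product[of V V] by (simp add: power2_eq_square)
  also have "\<dots> = card ?D + card ?B" using V finD by (intro card_Un_disjoint) auto
  finally show ?thesis using D B by simp
qed

text \<open>By Cauchy-Schwarz the squares of the four class sizes add up to at least
  \<open>n^2 / 4\<close>.\<close>

lemma turan_number_4_upper: "8 * real (turan_number n 4) \<le> 3 * (real n)\<^sup>2"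
proof -
  obtain c :: "nat \<Rightarrow> nat" where c: "c ` {..<n} \<subseteq> {..<4}" "turan_number n 4 = card (multipartite c {..<n})"
    using turan_number_multipartite[of 4 n] by auto
  let ?s = "\<lambda>i. real (card {u \<in> {..<n}. c u = i})"
  have eq: "2 * real (turan_number n 4) + (\<Sum>i<4. (?s i)\<^sup>2) = (real n)\<^sup>2"
    using arg_cong[OF card_multipartite[OF _ c(1)], of real] c(2) by simp
  have "(\<Union>i<4. {u \<in> {..<n}. c u = i}) = {..<n}" using c(1) by auto
  then have "n = card (\<Union>i<4. {u \<in> {..<n}. c u = i})" by simp
  also have "\<dots> = (\<Sum>i<4. card {u \<in> {..<n}. c u = i})" by (rule card_UN_disjoint) auto
  finally have n: "real n = (\<Sum>i<4. ?s i)" by (metis of_nat_sum)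
  have "(real n)\<^sup>2 \<le> 4 * (\<Sum>i<4. (?s i)\<^sup>2)"
    unfolding n using sum_squared_le_sum_of_squares[of ?s "{..<4}"] by simp
  then show ?thesis using eq by linarith
qed

text \<open>Residues modulo 4 give classes of size at most \<open>(n + 3) / 4\<close>.\<close>

lemma turan_number_4_lower: "8 * real (turan_number n 4) \<ge> 4 * (real n)\<^sup>2 - (real n + 3)\<^sup>2"
proof -
  let ?c = "\<lambda>u :: nat. u mod 4"
  have c: "?c ` {..<n} \<subseteq> {..<4}" by auto
  have card_le: "4 * card {u \<in> {..<n}. u mod 4 = i} \<le> n + 3" for i
  proof -
    have "inj_on (\<lambda>u. u div 4) {u \<in> {..<n}. u mod 4 = i}"
      by (rule inj_onI) (metis (mono_tags, lifting) div_mult_mod_eq mem_Collect_eq)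
    moreover have "(\<lambda>u. u div 4) ` {u \<in> {..<n}. u mod 4 = i} \<subseteq> {..<(n + 3) div 4}"
      by auto
    ultimately have "card {u \<in> {..<n}. u mod 4 = i} \<le> card {..<(n + 3) div 4}"
      by (intro card_inj_on_le) auto
    then show ?thesis by simp
  qed
  have le: "card (multipartite ?c {..<n}) \<le> turan_number n 4"
    by (intro le_turan_number multipartite_subset multipartite_clique_free c)
  let ?s = "\<lambda>i. real (card {u \<in> {..<n}. ?c u = i})"
  have "2 * real (card (multipartite ?c {..<n})) + (\<Sum>i<4. (?s i)\<^sup>2) = (real n)\<^sup>2"
    using arg_cong[OF card_multipartite[OF _ c], of real] by simp
  moreover have "(\<Sum>i<4. (?s i)\<^sup>2) \<le> (\<Sum>i<4::nat. ((real n + 3) / 4)\<^sup>2)"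
  proof (intro sum_mono power_mono)
    fix i show "?s i \<le> (real n + 3) / 4" using card_le[of i] by (simp add: field_simps)
  qed auto
  ultimately show ?thesis using le by (simp add: power_divide field_simps)
qed

lemma turan_number_4_asymptotics:
  "\<exists>\<epsilon> :: nat \<Rightarrow> real. \<epsilon> \<longlonglongrightarrow> 0 \<and>
     (\<forall>n\<ge>1. real (turan_number n 4) = (3 / 4 + \<epsilon> n) * real (n choose 2))"
proof -
  define \<epsilon> where "\<epsilon> n = real (turan_number n 4) / real (n choose 2) - 3 / 4" for n
  have ch: "real (n choose 2) = real n * (real n - 1) / 2" for n
    by (cases n) (simp_all add: choose_two real_of_nat_div algebra_simps)
  have "real (turan_number n 4) = (3 / 4 + \<epsilon> n) * real (n choose 2)" if "n \<ge> 1" for n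
  proof (cases "n = 1")
    case True
    \<comment> \<open>Here \<open>n choose 2\<close> is 0, so the equation holds only because its
      left side vanishes as well.\<close>
    have "turan_number 1 4 = 0" using turan_number_4_upper[of 1] by simp
    then show ?thesis using True by simp
  next
    case False
    then have "n choose 2 > 0" using that by simp
    then show ?thesis by (simp add: \<epsilon>_def)
  qed
  moreover have "\<epsilon> \<longlonglongrightarrow> 0"
  proof (rule tendsto_sandwich)
    show "\<forall>\<^sub>F n in sequentially. (4 * (real n)\<^sup>2 - (real n + 3)\<^sup>2) / (4 * (real n * (real n - 1))) - 3 / 4 \<le> \<epsilon> n"
      using eventually_ge_at_top[of 2]
    proof eventually_elim
      case (elim n)
      then have pos: "real n * (real n - 1) > 0" by simp
      have "(4 * (real n)\<^sup>2 - (real n + 3)\<^sup>2) / (4 * (real n * (real n - 1)))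
          \<le> 8 * real (turan_number n 4) / (4 * (real n * (real n - 1)))"
        using turan_number_4_lower[of n] pos by (intro divide_right_mono) auto
      then show ?case unfolding \<epsilon>_def ch by simp
    qed
    show "\<forall>\<^sub>F n in sequentially. \<epsilon> n \<le> 3 * (real n)\<^sup>2 / (4 * (real n * (real n - 1))) - 3 / 4"
      using eventually_ge_at_top[of 2]
    proof eventually_elim
      case (elim n)
      then have pos: "real n * (real n - 1) > 0" by simp
      have "8 * real (turan_number n 4) / (4 * (real n * (real n - 1)))
          \<le> 3 * (real n)\<^sup>2 / (4 * (real n * (real n - 1)))"
        using turan_number_4_upper[of n] pos by (intro divide_right_mono) auto
      then show ?case unfolding \<epsilon>_def ch by simp
    qed
  qed (real_asymp)+
  ultimately show ?thesis by blast
qed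

section \<open>Arrangements of open polyhedra\<close>

text \<open>The shift of indices makes the convex sets the vertices \<open>{..<n}\<close> used by
  \<open>turan_number\<close>.\<close>

lemma convex_union_compl_iff: "convex_union_compl n S \<longleftrightarrow> (\<exists>K. convex_cover {..<n} K S)"
proof
  assume "convex_union_compl n S"
  then obtain K where K: "\<forall>i\<in>{1..n}. convex (K i)" "S = UNIV - (\<Union>i\<in>{1..n}. K i)"
    by (auto simp: convex_union_compl_def)
  have "{1..n} = Suc ` {..<n}" by (simp add: image_Suc_lessThan)
  then have "convex_cover {..<n} (K \<circ> Suc) S" using K by unfold_locales auto
  then show "\<exists>K. convex_cover {..<n} K S" by blast
next
  assume "\<exists>K. convex_cover {..<n} K S"
  then obtain K where "convex_cover {..<n} K S" by blast
  then interpret convex_cover "{..<n}" K S .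
  have "{1..n} = Suc ` {..<n}" by (simp add: image_Suc_lessThan)
  then have "S = UNIV - (\<Union>i\<in>{1..n}. K (i - 1))" unfolding S_eq by simp
  moreover have "\<forall>i\<in>{1..n}. convex (K (i - 1))" using convex_K by auto
  ultimately show "convex_union_compl n S"
    unfolding convex_union_compl_def by (intro exI[of _ "\<lambda>i. K (i - 1)"] conjI)
qed

text \<open>
  The point \<open>p u v\<close> lies in the relative interior of the common facet of the \<open>u\<close>-th and the
  \<open>v\<close>-th polyhedron. The relation \<open>low\<close> orients the pairs that are separated by a hyperplane:
  polyhedron \<open>u\<close> is on the side \<open>A u v \<bullet> x > B u v\<close>.
\<close>

lemma facet_arrangement:
  fixes A :: "nat \<Rightarrow> nat \<Rightarrow> 'a::euclidean_space" and B :: "nat \<Rightarrow> nat \<Rightarrow> real"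
    and p :: "nat \<Rightarrow> nat \<Rightarrow> 'a" and low :: "nat \<Rightarrow> nat \<Rightarrow> bool"
  assumes zero: "\<And>u v. \<lbrakk>u < n; v < n; low u v\<rbrakk> \<Longrightarrow> A u v \<bullet> p u v = B u v"
    and left_up: "\<And>u v w. \<lbrakk>u < n; v < n; low u v; w < n; low u w; w \<noteq> v\<rbrakk> \<Longrightarrow> A u w \<bullet> p u v > B u w"
    and left_down: "\<And>u v w. \<lbrakk>u < n; v < n; low u v; w < n; low w u\<rbrakk> \<Longrightarrow> A w u \<bullet> p u v < B w u"
    and right_up: "\<And>u v w. \<lbrakk>u < n; v < n; low u v; w < n; low v w\<rbrakk> \<Longrightarrow> A v w \<bullet> p u v > B v w"
    and right_down: "\<And>u v w. \<lbrakk>u < n; v < n; low u v; w < n; low w v; w \<noteq> u\<rbrakk> \<Longrightarrow> A w v \<bullet> p u v < B w v"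
    and asym: "\<And>u v. low u v \<Longrightarrow> \<not> low v u"
    and neighbour: "\<And>u v w. \<lbrakk>u < n; v < n; low u v; w < n; w \<noteq> u; w \<noteq> v\<rbrakk>
      \<Longrightarrow> low u w \<or> low w u \<or> low v w \<or> low w v"
    and nonzero: "\<And>u v. \<lbrakk>u < n; v < n; low u v\<rbrakk> \<Longrightarrow> A u v \<noteq> 0"
    and distinct: "\<And>u v u' v'. \<lbrakk>u < n; v < n; low u v; u' < n; v' < n; low u' v'; (u, v) \<noteq> (u', v')\<rbrakk>
      \<Longrightarrow> {x. A u v \<bullet> x = B u v} \<noteq> {x. A u' v' \<bullet> x = B u' v'}"
  shows "\<exists>S :: 'a set. convex_union_compl n S \<and>
    card {(u, v). u < n \<and> v < n \<and> low u v} \<le> nu (int DIM('a) - 1) S"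
proof -
  define K where "K u = (\<Inter>w\<in>{w. w < n \<and> low u w}. {x. A u w \<bullet> x > B u w}) \<inter>
    (\<Inter>w\<in>{w. w < n \<and> low w u}. {x. A w u \<bullet> x < B w u})" for u
  define S where "S = UNIV - (\<Union>u\<in>{..<n}. K u)"
  interpret convex_cover "{..<n}" K S
  proof
    show "convex (K u)" for u
      unfolding K_def by (intro convex_Int convex_INT convex_halfspace_gt convex_halfspace_lt)
  qed (simp_all add: S_def)
  let ?H = "\<lambda>(u, v). {x. A u v \<bullet> x = B u v}"
  have ord: "ordinary_flat S (?H (u, v))" if uv: "u < n" "v < n" "low u v" for u v
  proof -
    \<comment> \<open>All constraints of \<open>K u\<close> and \<open>K v\<close> except their
      mutual one. Inside \<open>U\<close>, a point off the hyperplane is in \<open>K u\<close> or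
      \<open>K v\<close> according to its side, and any other \<open>K w\<close> is excluded by its
      constraint against \<open>u\<close> or \<open>v\<close>.\<close>
    define U where "U = (\<Inter>w\<in>{w. w < n \<and> low u w \<and> w \<noteq> v}. {x. A u w \<bullet> x > B u w}) \<inter>
      (\<Inter>w\<in>{w. w < n \<and> low w u}. {x. A w u \<bullet> x < B w u}) \<inter>
      (\<Inter>w\<in>{w. w < n \<and> low v w}. {x. A v w \<bullet> x > B v w}) \<inter>
      (\<Inter>w\<in>{w. w < n \<and> low w v \<and> w \<noteq> u}. {x. A w v \<bullet> x < B w v})"
    have "open U"
      unfolding U_def by (intro open_Int open_INT ballI open_halfspace_gt open_halfspace_lt) auto
    moreover have "p u v \<in> ?H (u, v) \<inter> U"
      using zero left_up left_down right_up right_down uv by (auto simp: U_def)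
    moreover have "S \<inter> U = ?H (u, v) \<inter> U"
    proof (intro equalityI subsetI)
      fix x assume x: "x \<in> S \<inter> U"
      then have "x \<notin> K u" "x \<notin> K v" using uv by (auto simp: S_def)
      have "A u v \<bullet> x \<le> B u v"
      proof (rule ccontr)
        assume "\<not> A u v \<bullet> x \<le> B u v"
        then have "x \<in> K u" using x by (auto simp: U_def K_def not_le)
        then show False using \<open>x \<notin> K u\<close> by simp
      qed
      moreover have "A u v \<bullet> x \<ge> B u v"
      proof (rule ccontr)
        assume "\<not> A u v \<bullet> x \<ge> B u v"
        then have "x \<in> K v" using x by (auto simp: U_def K_def not_le)
        then show False using \<open>x \<notin> K v\<close> by simp
      qed
      ultimately show "x \<in> ?H (u, v) \<inter> U" using x by auto
    next
      fix x assume x: "x \<in> ?H (u, v) \<inter> U"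
      have "x \<notin> K w" if w: "w < n" for w
      proof (cases "w = u \<or> w = v")
        case True
        then show ?thesis using x uv by (auto simp: K_def)
      next
        case False
        then have "low u w \<or> low w u \<or> low v w \<or> low w v" using neighbour uv w by blast
        then show ?thesis
        proof (elim disjE)
          assume "low u w"
          then have "A u w \<bullet> x > B u w" using x w False by (auto simp: U_def)
          then show ?thesis using \<open>low u w\<close> uv(1) by (auto simp: K_def intro: less_asym)
        next
          assume "low w u"
          then have "A w u \<bullet> x < B w u" using x w by (auto simp: U_def)
          then show ?thesis using \<open>low w u\<close> uv(1) by (auto simp: K_def intro: less_asym)
        next
          assume "low v w"
          then have "A v w \<bullet> x > B v w" using x w by (auto simp: U_def)
          then show ?thesis using \<open>low v w\<close> uv(2) by (auto simp: K_def intro: less_asym)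
        next
          assume "low w v"
          then have "A w v \<bullet> x < B w v" using x w False by (auto simp: U_def)
          then show ?thesis using \<open>low w v\<close> uv(2) by (auto simp: K_def intro: less_asym)
        qed
      qed
      then show "x \<in> S \<inter> U" using x by (auto simp: S_def)
    qed
    ultimately show ?thesis by (auto simp: ordinary_flat_def affine_hyperplane)
  qed
  let ?R = "{(u, v). u < n \<and> v < n \<and> low u v}"
  have "card ?R \<le> card {H. ordinary_flat S H \<and> aff_dim H = int DIM('a) - 1}"
  proof (rule card_inj_on_le)
    show "inj_on ?H ?R"
    proof (rule inj_onI)
      fix e e' assume "e \<in> ?R" "e' \<in> ?R" "?H e = ?H e'"
      then show "e = e'" using distinct[of "fst e" "snd e" "fst e'" "snd e'"] by force
    qed
    show "?H ` ?R \<subseteq> {H. ordinary_flat S H \<and> aff_dim H = int DIM('a) - 1}"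
    proof
      fix H assume "H \<in> ?H ` ?R"
      then obtain u v where uv: "u < n" "v < n" "low u v" "H = {x. A u v \<bullet> x = B u v}" by auto
      then have "aff_dim H = int DIM('a) - 1" using nonzero[OF uv(1-3)] by (simp add: aff_dim_hyperplane)
      then show "H \<in> {H. ordinary_flat S H \<and> aff_dim H = int DIM('a) - 1}"
        using ord[OF uv(1-3)] uv(4) by simp
    qed
  qed (rule ordinary_of_dim_finite)
  moreover have "convex_union_compl n S"
    using convex_union_compl_iff convex_cover_axioms by blast
  ultimately show ?thesis unfolding nu_eq[symmetric] by blast
qed

text \<open>
  Dimension at least 3: the \<open>u\<close>-th polyhedron is the set where \<open>- u^4 + x3 u^3 + x2 u^2 + x1 u\<close> is
  larger than the value at every other index, and the polynomial \<open>- (u - s)^2 (u - t)^2\<close> gives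
  the point on the facet between the polyhedra \<open>s\<close> and \<open>t\<close>.
\<close>

lemma neighbourly_arrangement:
  assumes d: "CARD('d::finite) \<ge> 3"
  shows "\<exists>S :: (real ^ 'd) set. convex_union_compl n S \<and> n choose 2 \<le> nu (int CARD('d) - 1) S"
proof -
  obtain T :: "'d set" where T: "card T = 3"
    using obtain_subset_with_card_n[OF d] by blast
  then obtain k1 k2 k3 :: 'd where k: "k1 \<noteq> k2" "k1 \<noteq> k3" "k2 \<noteq> k3"
    unfolding card_3_iff by auto
  define e where "e a b c = a *\<^sub>R axis k1 1 + b *\<^sub>R axis k2 1 + c *\<^sub>R (axis k3 1 :: real ^ 'd)" for a b c
  have ee: "e a b c \<bullet> e a' b' c' = a * a' + b * b' + c * c'" for a b c a' b' c'
    using k by (simp add: e_def inner_simps inner_axis_axis)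
  \<comment> \<open>\<open>A u v \<bullet> x - B u v\<close> is the value of the quartic at
    \<open>u\<close> minus its value at \<open>v\<close>.\<close>
  define A where "A u v = e (real u - real v) ((real u)^2 - (real v)^2) ((real u)^3 - (real v)^3)" for u v
  define B where "B u v = (real u)^4 - (real v)^4" for u v
  \<comment> \<open>The coefficients of \<open>- (w - u)^2 (w - v)^2\<close> as a polynomial in
    \<open>w\<close>; its constant term cancels in differences.\<close>
  define p where "p u v = e (2 * (real u + real v) * (real u * real v))
    (- ((real u + real v)^2 + 2 * real u * real v)) (2 * (real u + real v))" for u v
  define Q where "Q s t u = (real u - real s)^2 * (real u - real t)^2" for s t u
  have val: "A u v \<bullet> p s t - B u v = Q s t v - Q s t u" for u v s t
    unfolding A_def p_def B_def Q_def ee by algebra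
  have Q0: "Q s t s = 0" "Q s t t = 0" for s t by (simp_all add: Q_def)
  have Qpos: "Q s t w > 0" if "w \<noteq> s" "w \<noteq> t" for s t w using that by (simp add: Q_def)
  have "\<exists>S :: (real ^ 'd) set. convex_union_compl n S \<and>
    card {(u, v). u < n \<and> v < n \<and> u < v} \<le> nu (int DIM(real ^ 'd) - 1) S"
  proof (rule facet_arrangement[of n "(<)" A p B])
    fix u v :: nat
    assume "u < v"
    then have "A u v \<bullet> e 1 0 0 \<noteq> 0" unfolding A_def ee by simp
    then show "A u v \<noteq> 0" by auto
  next
    fix u v u' v' :: nat
    assume lt: "u < v" "u' < v'" and ne: "(u, v) \<noteq> (u', v')"
    define \<sigma> \<tau> \<sigma>' \<tau>' where "\<sigma> = real u + real v" and "\<tau> = (real u)^2 + (real v)^2"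
      and "\<sigma>' = real u' + real v'" and "\<tau>' = (real u')^2 + (real v')^2"
    \<comment> \<open>After division by \<open>u - v\<close> the equation only involves the sum of
      the two indices and the sum of their squares. Both can be read off from the points
      \<open>e a b 0\<close>, and they determine \<open>u < v\<close>.\<close>
    have mem: "A u v \<bullet> e a b 0 = B u v \<longleftrightarrow> a + (real u + real v) * b = (real u + real v) * ((real u)^2 + (real v)^2)"
      if "u < v" for u v a b
    proof -
      have "A u v \<bullet> e a b 0 - B u v = (real u - real v) *
          (a + (real u + real v) * b - (real u + real v) * ((real u)^2 + (real v)^2))"
        unfolding A_def B_def ee by algebra
      then show ?thesis using that by auto
    qed
    show "{x. A u v \<bullet> x = B u v} \<noteq> {x. A u' v' \<bullet> x = B u' v'}"
    proof
      assume eq: "{x. A u v \<bullet> x = B u v} = {x. A u' v' \<bullet> x = B u' v'}"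
      have iff: "a + \<sigma> * b = \<sigma> * \<tau> \<longleftrightarrow> a + \<sigma>' * b = \<sigma>' * \<tau>'" for a b
        using eq mem[OF lt(1), of a b] mem[OF lt(2), of a b]
        unfolding \<sigma>_def \<tau>_def \<sigma>'_def \<tau>'_def by blast
      have st: "\<sigma> * \<tau> = \<sigma>' * \<tau>'" using iff[of "\<sigma> * \<tau>" 0] by simp
      then have s: "\<sigma> = \<sigma>'" using iff[of "\<sigma> * \<tau> - \<sigma>" 1] by simp
      moreover have "\<sigma> > 0" using lt(1) by (simp add: \<sigma>_def)
      ultimately have t: "\<tau> = \<tau>'" using st by simp
      have "(real v - real u)^2 = 2 * \<tau> - \<sigma>^2" "(real v' - real u')^2 = 2 * \<tau>' - \<sigma>'^2"
        unfolding \<sigma>_def \<tau>_def \<sigma>'_def \<tau>'_def by algebra+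
      then have "(real v - real u)^2 = (real v' - real u')^2" using s t by simp
      then have "real v - real u = real v' - real u'" using lt by (simp add: power2_eq_iff_nonneg)
      then have "u = u'" "v = v'" using s by (auto simp: \<sigma>_def \<sigma>'_def)
      then show False using ne by simp
    qed
  next
    fix u v :: nat
    show "A u v \<bullet> p u v = B u v" using val[of u v u v] Q0 by simp
  next
    fix u v w :: nat
    assume "u < v" "u < w" "w \<noteq> v"
    then show "B u w < A u w \<bullet> p u v" using val[of u w u v] Q0 Qpos[of w u v] by simp
  next
    fix u v w :: nat
    assume "u < v" "w < u"
    then show "A w u \<bullet> p u v < B w u" using val[of w u u v] Q0 Qpos[of w u v] by simp
  next
    fix u v w :: nat
    assume "u < v" "v < w"
    then show "B v w < A v w \<bullet> p u v" using val[of v w u v] Q0 Qpos[of w u v] by simp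
  next
    fix u v w :: nat
    assume "u < v" "w < v" "w \<noteq> u"
    then show "A w v \<bullet> p u v < B w v" using val[of w v u v] Q0 Qpos[of w u v] by simp
  qed auto
  moreover have "n choose 2 \<le> card {(u, v). u < n \<and> v < n \<and> u < v}"
  proof -
    have fin: "finite {(u, v). u < n \<and> v < n \<and> u < v}"
      by (rule finite_subset[of _ "{..<n} \<times> {..<n}"]) auto
    have "nsets {..<n} 2 \<subseteq> (\<lambda>(u, v). {u, v}) ` {(u, v). u < n \<and> v < n \<and> u < v}"
    proof
      fix e assume "e \<in> nsets {..<n} 2"
      then obtain x y where xy: "e = {x, y}" "x < n" "y < n" "x \<noteq> y"
        by (metis lessThan_iff nsets2_E)
      then show "e \<in> (\<lambda>(u, v). {u, v}) ` {(u, v). u < n \<and> v < n \<and> u < v}"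
      proof (cases "x < y")
        case True
        then show ?thesis using xy by (intro image_eqI[of _ _ "(x, y)"]) auto
      next
        case False
        then show ?thesis using xy by (intro image_eqI[of _ _ "(y, x)"]) auto
      qed
    qed
    then have "card (nsets {..<n} 2) \<le> card ((\<lambda>(u, v). {u, v}) ` {(u, v). u < n \<and> v < n \<and> u < v})"
      using fin by (intro card_mono) auto
    also have "\<dots> \<le> card {(u, v). u < n \<and> v < n \<and> u < v}" using fin by (rule card_image_le)
    finally show ?thesis by (simp add: card_nsets)
  qed
  ultimately show ?thesis by fastforce
qed

section \<open>Four classes in the plane\<close>

text \<open>
  The regions where one of \<open>1, x, y, -x-y\<close> is largest are pairwise adjacent along segments or
  rays; \<open>center a b\<close> is a point in the interior of the common boundary of the regions \<open>a\<close> and \<open>b\<close>.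
\<close>

definition grad :: "nat \<Rightarrow> real ^ 2" where
  "grad a = vector [if a = 1 then 1 else if a = 3 then - 1 else 0, if a = 2 then 1 else if a = 3 then - 1 else 0]"

definition offs :: "nat \<Rightarrow> real" where
  "offs a = (if a = 0 then 1 else 0)"

definition center :: "nat \<Rightarrow> nat \<Rightarrow> real ^ 2" where
  "center a b =
    (if a = 0 then (if b = 1 then vector [1, 0] else if b = 2 then vector [0, 1] else vector [0, - 1])
     else if a = 1 then (if b = 2 then vector [2, 2] else vector [2, - 4])
     else vector [- 4, 2])"

lemma inner_vector_2: "(vector [a, b] :: real ^ 2) \<bullet> vector [c, d] = a * c + b * d"
  by (simp add: inner_vec_def sum_2)

definition height :: "nat \<Rightarrow> nat \<Rightarrow> nat \<Rightarrow> real" where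
  "height a b d = grad d \<bullet> center a b + offs d"

lemma less_4_cases: "(a::nat) < 4 \<Longrightarrow> a = 0 \<or> a = 1 \<or> a = 2 \<or> a = 3"
  by linarith

lemma height_eq: "a < b \<Longrightarrow> b < 4 \<Longrightarrow> height a b a = height a b b"
  using less_4_cases[of b] less_4_cases[of a]
  by (auto simp: height_def grad_def offs_def center_def inner_vector_2)

lemma height_less: "a < b \<Longrightarrow> b < 4 \<Longrightarrow> d < 4 \<Longrightarrow> d \<noteq> a \<Longrightarrow> d \<noteq> b \<Longrightarrow> height a b d < height a b a"
  using less_4_cases[of b] less_4_cases[of a] less_4_cases[of d]
  by (auto simp: height_def grad_def offs_def center_def inner_vector_2)

text \<open>The centres are chosen without further coincidences of heights. So the signs of all
  comparisons at a centre, apart from the pair that meets there, survive a small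
  perturbation.\<close>

lemma height_distinct:
  "a < b \<Longrightarrow> b < 4 \<Longrightarrow> d < e \<Longrightarrow> e < 4 \<Longrightarrow> (a, b) \<noteq> (d, e) \<Longrightarrow> height a b d \<noteq> height a b e"
  using less_4_cases[of b] less_4_cases[of a] less_4_cases[of d] less_4_cases[of e]
  by (auto simp: height_def grad_def offs_def center_def inner_vector_2)

text \<open>
  Near the boundary of two regions, the line \<open>y = slope i j * x + const i j\<close> separates the \<open>i\<close>-th
  set of the upper class from the \<open>j\<close>-th set of the lower class. It is the tangent at
  \<open>contact i j = i + \<delta> j\<close> to the parabola \<open>y = - x^2 + 2 (x - i)^2\<close>. At the contact
  point, the lines form a matrix with a strict saddle point at \<open>(i, j)\<close>.
\<close>

definition slope :: "real \<Rightarrow> nat \<Rightarrow> nat \<Rightarrow> real" where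
  "slope \<delta> i j = 2 * (\<delta> * real j - real i)"

definition const :: "real \<Rightarrow> nat \<Rightarrow> nat \<Rightarrow> real" where
  "const \<delta> i j = 2 * (real i)\<^sup>2 - (real i + \<delta> * real j)\<^sup>2"

definition contact :: "real \<Rightarrow> nat \<Rightarrow> nat \<Rightarrow> real" where
  "contact \<delta> i j = real i + \<delta> * real j"

definition line_val :: "real \<Rightarrow> nat \<Rightarrow> nat \<Rightarrow> nat \<Rightarrow> nat \<Rightarrow> real" where
  "line_val \<delta> i j i' j' = slope \<delta> i' j' * contact \<delta> i j + const \<delta> i' j'"

text \<open>For \<open>i' = i\<close> only the last term remains: tangents of one convex parabola
  lie below it. For \<open>i' \<noteq> i\<close> the first term dominates when
  \<open>\<delta>\<close> is small.\<close>

lemma line_val_diff: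
  "line_val \<delta> i j i' j' - line_val \<delta> i j i j =
    (real i - real i')\<^sup>2 + 2 * (real i - real i') * \<delta> * (real j + real j') - \<delta>\<^sup>2 * (real j - real j')\<^sup>2"
  unfolding line_val_def slope_def const_def contact_def by algebra

lemma line_val_same_row:
  assumes "\<delta> > 0" "j \<noteq> j'"
  shows "line_val \<delta> i j i j' < line_val \<delta> i j i j"
proof -
  have "\<delta>\<^sup>2 * (real j - real j')\<^sup>2 > 0" using assms by simp
  then show ?thesis using line_val_diff[of \<delta> i j i j'] by simp
qed

text \<open>With \<open>D\<close> the distance of \<open>i\<close> and \<open>i'\<close>, the choice
  of \<open>\<delta>\<close> bounds the mixed term by \<open>D / 2\<close> and the last one by
  \<open>1 / 16\<close>, against a leading term \<open>D^2 \<ge> D \<ge> 1\<close>.\<close>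

lemma line_val_other_row:
  assumes "n > 0" "\<delta> = 1 / (8 * real n)" "j < n" "j' < n" "i \<noteq> i'"
  shows "line_val \<delta> i j i' j' > line_val \<delta> i j i j"
proof -
  define D where "D = \<bar>real i - real i'\<bar>"
  have D: "D \<ge> 1" using assms(5) by (simp add: D_def)
  have \<delta>: "\<delta> > 0" using assms by simp
  have s: "\<delta> * (real j + real j') \<le> 1 / 4"
  proof -
    have "real j + real j' \<le> 2 * real n" using assms by simp
    then have "\<delta> * (real j + real j') \<le> \<delta> * (2 * real n)" using \<delta> by (intro mult_left_mono) auto
    then show ?thesis using assms(1,2) by simp
  qed
  have s0: "\<delta> * (real j + real j') \<ge> 0" using \<delta> by simp
  have "\<bar>\<delta> * (real j - real j')\<bar> \<le> 1 / 4"
  proof -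
    have "\<bar>\<delta> * (real j - real j')\<bar> = \<delta> * \<bar>real j - real j'\<bar>" using \<delta> by (simp add: abs_mult)
    also have "\<dots> \<le> \<delta> * (real j + real j')" using \<delta> by (intro mult_left_mono) auto
    finally show ?thesis using s by simp
  qed
  then have "(\<delta> * (real j - real j'))\<^sup>2 \<le> (1 / 4)\<^sup>2" by (metis abs_le_square_iff abs_of_nonneg divide_nonneg_nonneg zero_le_numeral zero_le_one)
  then have 1: "\<delta>\<^sup>2 * (real j - real j')\<^sup>2 \<le> 1 / 16" by (simp add: power_mult_distrib power_divide)
  have "\<bar>2 * q * \<delta> * (real j + real j')\<bar> = 2 * \<bar>q\<bar> * (\<delta> * (real j + real j'))" for q
    using \<delta> by (simp add: abs_mult)
  then have "\<bar>2 * (real i - real i') * \<delta> * (real j + real j')\<bar> = 2 * D * (\<delta> * (real j + real j'))"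
    unfolding D_def .
  also have "\<dots> \<le> 2 * D * (1 / 4)" using s D by (intro mult_left_mono) auto
  finally have 2: "2 * (real i - real i') * \<delta> * (real j + real j') \<ge> - (D / 2)" by (simp add: abs_le_iff)
  have "(real i - real i')\<^sup>2 = D\<^sup>2" by (simp add: D_def)
  then have 3: "(real i - real i')\<^sup>2 \<ge> D" using self_le_power[OF D, of 2] by simp
  show ?thesis using line_val_diff[of \<delta> i j i' j'] 1 2 3 D by linarith
qed

section \<open>Transplanting the broken lines to the four regions\<close>

definition diff_grad :: "nat \<Rightarrow> nat \<Rightarrow> real ^ 2" where
  "diff_grad a b = grad a - grad b"

definition along :: "nat \<Rightarrow> nat \<Rightarrow> real ^ 2" where
  "along a b = vector [- (diff_grad a b $ 2), diff_grad a b $ 1]"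

lemma along_orthogonal: "diff_grad a b \<bullet> along a b = 0" "along a b \<bullet> diff_grad a b = 0"
  by (simp_all add: along_def inner_vec_def sum_2)

lemma diff_grad_nonzero: "a < b \<Longrightarrow> b < 4 \<Longrightarrow> diff_grad a b \<noteq> 0"
  using less_4_cases[of b] less_4_cases[of a]
  by (auto simp: diff_grad_def grad_def vec_eq_iff forall_2)

lemma along_nonzero: "a < b \<Longrightarrow> b < 4 \<Longrightarrow> along a b \<noteq> 0"
  using diff_grad_nonzero[of a b] by (auto simp: along_def vec_eq_iff forall_2)

lemma plane_arrangement:
  fixes c :: "nat \<Rightarrow> nat"
  assumes n: "n > 0" and c: "c ` {..<n} \<subseteq> {..<4}"
  shows "\<exists>S :: (real ^ 2) set. convex_union_compl n S \<and> card (multipartite c {..<n}) \<le> nu 1 S"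
proof -
  define \<delta> where "\<delta> = 1 / (8 * real n)"
  have \<delta>: "\<delta> > 0" using n by (simp add: \<delta>_def)
  have c4: "c u < 4" if "u < n" for u using c that by auto
  \<comment> \<open>Parabolic rescaling: for displacements from the centre, let \<open>X\<close> and
    \<open>Y\<close> be the inner products with \<open>along\<close> and \<open>diff_grad\<close>.
    With \<open>X = \<sigma> x\<close> and \<open>Y = \<sigma>^2 y\<close> the line
    \<open>y = slope x + const\<close> becomes
    \<open>Y = \<sigma> slope X + \<sigma>^2 const\<close>.\<close>
  define A where "A \<sigma> u v = diff_grad (c u) (c v) - (\<sigma> * slope \<delta> u v) *\<^sub>R along (c u) (c v)" for \<sigma> u v
  define B where "B \<sigma> u v = A \<sigma> u v \<bullet> center (c u) (c v) + \<sigma>\<^sup>2 * const \<delta> u v" for \<sigma> u v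
  \<comment> \<open>The contact point in the rescaled coordinates; the divisions compensate for the
    lengths of the two orthogonal axes.\<close>
  define p where "p \<sigma> u v = center (c u) (c v)
      + (\<sigma> * contact \<delta> u v / (along (c u) (c v) \<bullet> along (c u) (c v))) *\<^sub>R along (c u) (c v)
      + (\<sigma>\<^sup>2 * line_val \<delta> u v u v / (diff_grad (c u) (c v) \<bullet> diff_grad (c u) (c v))) *\<^sub>R diff_grad (c u) (c v)"
    for \<sigma> u v
  have same: "A \<sigma> u' v' \<bullet> p \<sigma> u v - B \<sigma> u' v' = \<sigma>\<^sup>2 * (line_val \<delta> u v u v - line_val \<delta> u v u' v')"
    if "u < n" "v < n" "c u < c v" "c u' = c u" "c v' = c v" for \<sigma> u v u' v'
  proof -
    let ?G = "diff_grad (c u) (c v)" and ?D = "along (c u) (c v)"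
    have ne: "?G \<bullet> ?G \<noteq> 0" "?D \<bullet> ?D \<noteq> 0"
      using diff_grad_nonzero along_nonzero c4 that by auto
    have pc: "p \<sigma> u v - center (c u) (c v) = (\<sigma> * contact \<delta> u v / (?D \<bullet> ?D)) *\<^sub>R ?D
        + (\<sigma>\<^sup>2 * line_val \<delta> u v u v / (?G \<bullet> ?G)) *\<^sub>R ?G" by (simp add: p_def)
    have G: "?G \<bullet> (p \<sigma> u v - center (c u) (c v)) = \<sigma>\<^sup>2 * line_val \<delta> u v u v"
      unfolding pc using ne(1) by (simp add: inner_add_right along_orthogonal)
    have D: "?D \<bullet> (p \<sigma> u v - center (c u) (c v)) = \<sigma> * contact \<delta> u v"
      unfolding pc using ne(2) by (simp add: inner_add_right along_orthogonal)
    have "A \<sigma> u' v' \<bullet> p \<sigma> u v - B \<sigma> u' v' =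
        A \<sigma> u' v' \<bullet> (p \<sigma> u v - center (c u) (c v)) - \<sigma>\<^sup>2 * const \<delta> u' v'"
      using that by (simp add: B_def inner_diff_right)
    also have "A \<sigma> u' v' \<bullet> (p \<sigma> u v - center (c u) (c v)) =
        ?G \<bullet> (p \<sigma> u v - center (c u) (c v)) - \<sigma> * slope \<delta> u' v' * (?D \<bullet> (p \<sigma> u v - center (c u) (c v)))"
      using that by (simp add: A_def inner_diff_left)
    also have "\<dots> - \<sigma>\<^sup>2 * const \<delta> u' v' = \<sigma>\<^sup>2 * (line_val \<delta> u v u v - line_val \<delta> u v u' v')"
      unfolding G D line_val_def[of \<delta> u v u' v'] by (simp add: algebra_simps power2_eq_square)
    finally show ?thesis .
  qed
  \<comment> \<open>At \<open>\<sigma> = 0\<close> the perturbation disappears and the comparison is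
    one between the original affine functions at the centre.\<close>
  define L where "L u v u' v' = height (c u) (c v) (c u') - height (c u) (c v) (c v')" for u v u' v'
  have lim: "((\<lambda>\<sigma>. A \<sigma> u' v' \<bullet> p \<sigma> u v - B \<sigma> u' v') \<longlongrightarrow> L u v u' v') (at_right 0)"
    if "u' < n" "v' < n" "c u' < c v'" for u v u' v'
  proof -
    have "((\<lambda>\<sigma>. A \<sigma> u' v' \<bullet> p \<sigma> u v - B \<sigma> u' v') \<longlongrightarrow> A 0 u' v' \<bullet> p 0 u v - B 0 u' v') (at_right 0)"
      unfolding A_def B_def p_def divide_inverse by (intro tendsto_intros)
    also have "A 0 u' v' \<bullet> p 0 u v - B 0 u' v' = L u v u' v'"
      using height_eq[of "c u'" "c v'"] c4 that
      by (simp add: A_def B_def p_def L_def height_def diff_grad_def inner_diff_left)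
    finally show ?thesis .
  qed
  \<comment> \<open>There are finitely many pairs of facets, so one small \<open>\<sigma>\<close>
    serves all of them. A positive product with \<open>L\<close> says that the perturbed comparison
    keeps the sign of its nonzero limit.\<close>
  define R where "R = {(u, v). u < n \<and> v < n \<and> c u < c v}"
  have finR: "finite R" by (rule finite_subset[of _ "{..<n} \<times> {..<n}"]) (auto simp: R_def)
  have "\<forall>\<^sub>F \<sigma> in at_right 0. \<forall>e\<in>R \<times> R. case e of ((u, v), (u', v')) \<Rightarrow>
      (c u, c v) \<noteq> (c u', c v') \<longrightarrow> (A \<sigma> u' v' \<bullet> p \<sigma> u v - B \<sigma> u' v') * L u v u' v' > 0"
  proof (rule eventually_ball_finite)
    show "\<forall>e\<in>R \<times> R. \<forall>\<^sub>F \<sigma> in at_right 0. case e of ((u, v), (u', v')) \<Rightarrow>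
      (c u, c v) \<noteq> (c u', c v') \<longrightarrow> (A \<sigma> u' v' \<bullet> p \<sigma> u v - B \<sigma> u' v') * L u v u' v' > 0"
    proof
      fix e assume "e \<in> R \<times> R"
      then obtain u v u' v' where e: "e = ((u, v), (u', v'))" and
        uv: "u < n" "v < n" "c u < c v" "u' < n" "v' < n" "c u' < c v'" by (auto simp: R_def)
      have "\<forall>\<^sub>F \<sigma> in at_right 0. (A \<sigma> u' v' \<bullet> p \<sigma> u v - B \<sigma> u' v') * L u v u' v' > 0"
        if "(c u, c v) \<noteq> (c u', c v')"
      proof (rule order_tendstoD(1))
        show "((\<lambda>\<sigma>. (A \<sigma> u' v' \<bullet> p \<sigma> u v - B \<sigma> u' v') * L u v u' v') \<longlongrightarrow> L u v u' v' * L u v u' v') (at_right 0)"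
          by (intro tendsto_mult_right lim uv)
        have "L u v u' v' \<noteq> 0"
          using height_distinct[of "c u" "c v" "c u'" "c v'"] uv c4 that by (simp add: L_def)
        then show "0 < L u v u' v' * L u v u' v'" by (auto simp: zero_less_mult_iff)
      qed
      then show "\<forall>\<^sub>F \<sigma> in at_right 0. case e of ((u, v), (u', v')) \<Rightarrow>
          (c u, c v) \<noteq> (c u', c v') \<longrightarrow> (A \<sigma> u' v' \<bullet> p \<sigma> u v - B \<sigma> u' v') * L u v u' v' > 0"
        unfolding e by (cases "(c u, c v) \<noteq> (c u', c v')") auto
    qed
  qed (use finR in simp)
  moreover have "\<forall>\<^sub>F \<sigma> in at_right (0::real). \<sigma> > 0" by (rule eventually_at_right_less)
  ultimately obtain \<sigma> :: real where \<sigma>: "\<sigma> > 0" and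
    sgn: "\<forall>e\<in>R \<times> R. case e of ((u, v), (u', v')) \<Rightarrow>
      (c u, c v) \<noteq> (c u', c v') \<longrightarrow> (A \<sigma> u' v' \<bullet> p \<sigma> u v - B \<sigma> u' v') * L u v u' v' > 0"
    using eventually_happens'[OF trivial_limit_at_right_real] eventually_conj by blast
  have other: "(A \<sigma> u' v' \<bullet> p \<sigma> u v - B \<sigma> u' v') * L u v u' v' > 0"
    if "u < n" "v < n" "c u < c v" "u' < n" "v' < n" "c u' < c v'" "(c u, c v) \<noteq> (c u', c v')" for u v u' v'
    using bspec[OF sgn, of "((u, v), (u', v'))"] that by (simp add: R_def)
  have row: "line_val \<delta> u v u w < line_val \<delta> u v u v" if "v \<noteq> w" for u v w
    using line_val_same_row[OF \<delta> that] .
  have col: "line_val \<delta> u v u v < line_val \<delta> u v w w'" if "v < n" "w' < n" "u \<noteq> w" for u v w w'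
    using line_val_other_row[OF n \<delta>_def that] .
  have "\<exists>S :: (real ^ 2) set. convex_union_compl n S \<and>
    card {(u, v). u < n \<and> v < n \<and> c u < c v} \<le> nu (int DIM(real ^ 2) - 1) S"
  proof (rule facet_arrangement[of n "\<lambda>u v. c u < c v" "A \<sigma>" "p \<sigma>" "B \<sigma>"])
    fix u v assume uv: "u < n" "v < n" "c u < c v"
    show "A \<sigma> u v \<bullet> p \<sigma> u v = B \<sigma> u v" using same[OF uv refl refl, of \<sigma>] by simp
    show "A \<sigma> u v \<noteq> 0"
    proof
      assume "A \<sigma> u v = 0"
      then have "diff_grad (c u) (c v) \<bullet> A \<sigma> u v = 0" by simp
      then show False
        using diff_grad_nonzero[of "c u" "c v"] c4 uv by (simp add: A_def inner_diff_right along_orthogonal)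
    qed
  next
    fix u v w assume uv: "u < n" "v < n" "c u < c v" and w: "w < n" "c u < c w" "w \<noteq> v"
    have "0 < A \<sigma> u w \<bullet> p \<sigma> u v - B \<sigma> u w"
    proof (cases "c w = c v")
      case True
      then show ?thesis using same[OF uv refl True, of \<sigma>] row[of v w u] w \<sigma> by simp
    next
      case False
      then have "L u v u w > 0"
        using height_less[of "c u" "c v" "c w"] uv w c4 by (simp add: L_def)
      then show ?thesis using other[OF uv uv(1) w(1,2)] False by (auto simp: zero_less_mult_iff)
    qed
    then show "B \<sigma> u w < A \<sigma> u w \<bullet> p \<sigma> u v" by simp
  next
    fix u v w assume uv: "u < n" "v < n" "c u < c v" and w: "w < n" "c w < c u"
    have "L u v w u < 0"
      using height_less[of "c u" "c v" "c w"] uv w c4 by (simp add: L_def)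
    then show "A \<sigma> w u \<bullet> p \<sigma> u v < B \<sigma> w u"
      using other[OF uv w(1) uv(1) w(2)] w by (auto simp: zero_less_mult_iff)
  next
    fix u v w assume uv: "u < n" "v < n" "c u < c v" and w: "w < n" "c v < c w"
    have "L u v v w > 0"
      using height_less[of "c u" "c v" "c w"] height_eq[of "c u" "c v"] uv w c4 by (simp add: L_def)
    then show "B \<sigma> v w < A \<sigma> v w \<bullet> p \<sigma> u v"
      using other[OF uv uv(2) w(1,2)] w by (auto simp: zero_less_mult_iff)
  next
    fix u v w assume uv: "u < n" "v < n" "c u < c v" and w: "w < n" "c w < c v" "w \<noteq> u"
    have "0 > A \<sigma> w v \<bullet> p \<sigma> u v - B \<sigma> w v"
    proof (cases "c w = c u")
      case True
      then show ?thesis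
        using same[OF uv True refl, of \<sigma>] col[OF uv(2,2), of u w] w \<sigma> by (simp add: mult_less_0_iff)
    next
      case False
      then have "L u v w v < 0"
        using height_less[of "c u" "c v" "c w"] height_eq[of "c u" "c v"] uv w c4 by (simp add: L_def)
      then show ?thesis using other[OF uv w(1) uv(2) w(2)] False by (auto simp: zero_less_mult_iff)
    qed
    then show "A \<sigma> w v \<bullet> p \<sigma> u v < B \<sigma> w v" by simp
  next
    fix u v u' v'
    assume uv: "u < n" "v < n" "c u < c v" and uv': "u' < n" "v' < n" "c u' < c v'" and ne: "(u, v) \<noteq> (u', v')"
    have "A \<sigma> u' v' \<bullet> p \<sigma> u v - B \<sigma> u' v' \<noteq> 0"
    proof (cases "(c u, c v) = (c u', c v')")
      case True
      then have "A \<sigma> u' v' \<bullet> p \<sigma> u v - B \<sigma> u' v' = \<sigma>\<^sup>2 * (line_val \<delta> u v u v - line_val \<delta> u v u' v')"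
        by (intro same[OF uv]) auto
      moreover have "line_val \<delta> u v u v \<noteq> line_val \<delta> u v u' v'"
        using row[of v v' u] col[OF uv(2) uv'(2), of u u'] ne by (cases "u = u'") auto
      ultimately show ?thesis using \<sigma> by simp
    next
      case False
      then show ?thesis using other[OF uv uv'] by auto
    qed
    moreover have "A \<sigma> u v \<bullet> p \<sigma> u v = B \<sigma> u v" using same[OF uv refl refl, of \<sigma>] by simp
    ultimately show "{x. A \<sigma> u v \<bullet> x = B \<sigma> u v} \<noteq> {x. A \<sigma> u' v' \<bullet> x = B \<sigma> u' v'}" by auto
  \<comment> \<open>What remains is asymmetry and \<open>neighbour\<close>: as \<open>u\<close> and
    \<open>v\<close> have different classes, \<open>w\<close> differs in class from one of
    them.\<close>
  qed auto
  moreover have "card (multipartite c {..<n}) \<le> card {(u, v). u < n \<and> v < n \<and> c u < c v}"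
  proof -
    have "multipartite c {..<n} \<subseteq> (\<lambda>(u, v). {u, v}) ` R"
    proof
      fix e assume "e \<in> multipartite c {..<n}"
      then obtain u v where uv: "e = {u, v}" "u < n" "v < n" "c u \<noteq> c v" by (auto simp: multipartite_def)
      show "e \<in> (\<lambda>(u, v). {u, v}) ` R"
      proof (cases "c u < c v")
        case True
        then show ?thesis using uv by (intro image_eqI[of _ _ "(u, v)"]) (auto simp: R_def)
      next
        case False
        then show ?thesis using uv by (intro image_eqI[of _ _ "(v, u)"]) (auto simp: R_def)
      qed
    qed
    then have "card (multipartite c {..<n}) \<le> card ((\<lambda>(u, v). {u, v}) ` R)" using finR by (intro card_mono) auto
    also have "\<dots> \<le> card R" using finR by (rule card_image_le)
    finally show ?thesis by (simp add: R_def)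
  qed
  ultimately show ?thesis by fastforce
qed

section \<open>The extremal numbers\<close>

text \<open>The upper bound also makes the set of values finite, so that \<open>Max\<close> is
  meaningful.\<close>

lemma nu_max_eqI:
  assumes "\<And>S :: 'a set. convex_union_compl n S \<Longrightarrow> nu k S \<le> m"
    and "\<exists>S :: 'a set. convex_union_compl n S \<and> m \<le> nu k S"
  shows "nu_max TYPE('a::euclidean_space) k n = m"
proof -
  let ?M = "{nu k S | S :: 'a set. convex_union_compl n S}"
  have "finite ?M" by (rule finite_subset[of _ "{..m}"]) (use assms(1) in auto)
  moreover have "m \<in> ?M" using assms by (metis (mono_tags, lifting) antisym mem_Collect_eq)
  ultimately show ?thesis unfolding nu_max_def using assms(1) by (intro Max_eqI) auto
qed

lemma nu_hyperplanes_le_choose: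
  fixes S :: "'a::euclidean_space set"
  assumes "convex_union_compl n S"
  shows "nu (int DIM('a) - 1) S \<le> n choose 2"
proof -
  obtain K where "convex_cover {..<n} K S" using assms convex_union_compl_iff by blast
  then interpret convex_cover "{..<n}" K S .
  have "card touching_pairs \<le> card (nsets {..<n} 2)"
    using touching_pairs_subset by (intro card_mono finite_imp_finite_nsets) auto
  then show ?thesis using nu_hyperplanes_le by (simp add: card_nsets)
qed

lemma nu_lines_le_turan:
  fixes S :: "(real ^ 2) set"
  assumes "convex_union_compl n S"
  shows "nu 1 S \<le> turan_number n 4"
proof -
  obtain K where "convex_cover {..<n} K S" using assms convex_union_compl_iff by blast
  then interpret convex_cover "{..<n}" K S .
  have "\<not> (\<exists>V\<in>nsets {..<n} (4 + 1). clique V touching_pairs)"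
  proof
    assume "\<exists>V\<in>nsets {..<n} (4 + 1). clique V touching_pairs"
    then obtain V where V: "V \<subseteq> {..<n}" "card V = 5" "clique V touching_pairs"
      by (auto simp: nsets_def)
    have "\<exists>H. touch_along H (K i) (K j)" if "i \<in> V" "j \<in> V" "i \<noteq> j" for i j
    proof -
      have "{i, j} \<in> touching_pairs" using V(3) that by (auto simp: clique_def)
      then obtain i' j' H where "{i, j} = {i', j'}" "touch_along H (K i') (K j')"
        unfolding touching_pairs_def by blast
      then show ?thesis using touch_along_sym by (auto simp: doubleton_eq_iff)
    qed
    then show False using V by (intro no_five_touching[of V K] convex_K) auto
  qed
  then have "card touching_pairs \<le> turan_number n 4"
    by (intro le_turan_number touching_pairs_subset)
  then show ?thesis using nu_hyperplanes_le by simp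
qed

theorem theorem1p8:
  shows "(\<forall>n\<ge>1. nu_max TYPE(real ^ 2) 1 n = turan_number n 4) \<and>
         (\<exists>\<epsilon> :: nat \<Rightarrow> real. \<epsilon> \<longlonglongrightarrow> 0 \<and>
            (\<forall>n\<ge>1. real (turan_number n 4) = (3 / 4 + \<epsilon> n) * real (n choose 2))) \<and>
         (CARD('d::finite) \<ge> 3 \<longrightarrow>
            (\<forall>n\<ge>1. nu_max TYPE(real ^ 'd) (int CARD('d) - 1) n = n choose 2))"
proof (intro conjI impI allI)
  fix n :: nat assume "n \<ge> 1"
  obtain c :: "nat \<Rightarrow> nat" where "c ` {..<n} \<subseteq> {..<4}" "turan_number n 4 = card (multipartite c {..<n})"
    by (rule turan_number_multipartite[of 4 n]) auto
  then show "nu_max TYPE(real ^ 2) 1 n = turan_number n 4"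
    using plane_arrangement[of n c] \<open>n \<ge> 1\<close> by (intro nu_max_eqI nu_lines_le_turan) auto
next
  show "\<exists>\<epsilon> :: nat \<Rightarrow> real. \<epsilon> \<longlonglongrightarrow> 0 \<and>
      (\<forall>n\<ge>1. real (turan_number n 4) = (3 / 4 + \<epsilon> n) * real (n choose 2))"
    by (rule turan_number_4_asymptotics)
next
  fix n :: nat assume "CARD('d) \<ge> 3"
  then show "nu_max TYPE(real ^ 'd) (int CARD('d) - 1) n = n choose 2"
    using nu_hyperplanes_le_choose[where 'a = "real ^ 'd"] neighbourly_arrangement[of n]
    by (intro nu_max_eqI) auto
qed

end
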